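(* Fix $\sigma\ge 1$. There exists a constant $\beta>0$ (depending only on the fixed shape-regularity bound $\sigma$, and in particular independent of the size and the aspect ratio of the elements of $\mathscr{P}$) such that for every triangulated edge patch $\omega\subset\mathbb{R}^2$, that is, every triangulation $\mathscr{P}$ obtained by dividing each rectangle of an edge patch of one of the types (d), (e), (f) described in the context into two triangles of equal area by a diagonal, $$\inf_{0\neq q\in M_{\mathscr{P}}(\omega)}\ \sup_{\boldsymbol{0}\neq\boldsymbol{v}\in \boldsymbol{V}_{\mathscr{P}}(\omega)}\ \frac{\int_\omega q\,\operatorname{div}\boldsymbol{v}\,\mathrm{d}\boldsymbol{x}}{|\boldsymbol{v}|_{1,\omega}\,\|q\|_{0,\omega}}\ \ge\ \beta ,$$ where $M_{\mathscr{P}}(\omega)$ and $\boldsymbol{V}_{\mathscr{P}}(\omega)$ are the $\mathbb{P}_1$ pressure space and the $\mathbb{P}_2$ velocity space on $\mathscr{P}$.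
   Context: **Spaces.** For a polygonal set $\omega$ with a conforming triangulation $\mathscr{P}$, $\mathbb{P}_\ell(K)$ is the space of polynomials on $K$ of total degree at most $\ell$. $M_{\mathscr{P}}(\omega)$ is the space of functions continuous on $\omega$, belonging to $\mathbb{P}_1(K)$ on each triangle $K\in\mathscr{P}$, with $\int_\omega q=0$. $\boldsymbol{V}_{\mathscr{P}}(\omega)$ is the space of continuous vector fields $\boldsymbol{v}:\omega\to\mathbb{R}^2$ with $\boldsymbol{v}|_K\in\mathbb{P}_2(K)^2$ for each $K\in\mathscr{P}$ and $\boldsymbol{v}=\boldsymbol{0}$ on $\partial\omega$. $\|\cdot\|_{0,\omega}$ is the $L^2(\omega)$ norm and $|\boldsymbol{v}|_{1,\omega}=\|\nabla\boldsymbol{v}\|_{0,\omega}$. **Edge patches (rectangular partitions before triangulating)** (up to a rigid motion of the plane that maps the coordinate directions to the coordinate directions). In each case every "long and thin" cell of a coarse patch has been bisected into two "long and thin" cells by a division orthogonal to its long side. Types (d) and (e): $\omega=M\cup M'$ with flat part $M=[-H,H]\times[-h,h]$ and shape-regular part $M'=[-H,H]\times[h,h+L]$, where $0<h\le H$ and $\sigma^{-1}H\le L\le \sigma H$. The part $M'$ is divided into two cells by the line $x=0$. In type (d), $M$ is divided into two cells by the line $x=0$; in type (e), $M$ is divided into four cells by the lines $x=0$ and $y=0$. Type (f) ("overlapped" edge patch): $\omega=T_1\cup T_2\cup M'$ is L-shaped, with $T_1=[h_1,A_1]\times[0,h_2]$, $T_2=[0,h_1]\times[h_2,A_2]$, $M'=[h_1,A_1]\times[h_2,A_2]$,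 where $0<h_i\le A_i/2$ for $i=1,2$ and the ratios $A_1/A_2$ and $h_1/h_2$ lie in $[\sigma^{-1},\sigma]$. $M'$ is divided into four congruent cells by the lines $x=(h_1+A_1)/2$ and $y=(h_2+A_2)/2$; $T_1$ is divided by the line $x=(h_1+A_1)/2$, $T_2$ by the line $y=(h_2+A_2)/2$; in addition, $T_1$ may or may not be divided by the line $y=h_2/2$, and $T_2$ may or may not be divided by the line $x=h_1/2$. *)

theory Defs
  imports "HOL-Analysis.Analysis"
begin

definition pt :: "real \<Rightarrow> real \<Rightarrow> real^2" where
  "pt x y = vector [x, y]"

(* The tuple (a, b, c, d) stands for the rectangle [a,b] x [c,d]. *)
type_synonym rectangle = "real \<times> real \<times> real \<times> real"

inductive edge_partition :: "real \<Rightarrow> rectangle set \<Rightarrow> bool" for \<sigma> :: real where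
  type_d: "\<lbrakk>0 < h; h \<le> H; H / \<sigma> \<le> L; L \<le> \<sigma> * H\<rbrakk> \<Longrightarrow>
    edge_partition \<sigma>
      ({(-H, 0, -h, h), (0, H, -h, h)} \<union>
       {(-H, 0, h, h + L), (0, H, h, h + L)})"
| type_e: "\<lbrakk>0 < h; h \<le> H; H / \<sigma> \<le> L; L \<le> \<sigma> * H\<rbrakk> \<Longrightarrow>
    edge_partition \<sigma>
      ({(-H, 0, -h, 0), (0, H, -h, 0), (-H, 0, 0, h), (0, H, 0, h)} \<union>
       {(-H, 0, h, h + L), (0, H, h, h + L)})"
| type_f: "\<lbrakk>0 < h1; h1 \<le> A1 / 2; 0 < h2; h2 \<le> A2 / 2;
     1 / \<sigma> \<le> A1 / A2; A1 / A2 \<le> \<sigma>; 1 / \<sigma> \<le> h1 / h2; h1 / h2 \<le> \<sigma>;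
     m1 = (h1 + A1) / 2; m2 = (h2 + A2) / 2;
     T1 = {(h1, m1, 0, h2), (m1, A1, 0, h2)} \<or>
     T1 = {(h1, m1, 0, h2 / 2), (m1, A1, 0, h2 / 2), (h1, m1, h2 / 2, h2), (m1, A1, h2 / 2, h2)};
     T2 = {(0, h1, h2, m2), (0, h1, m2, A2)} \<or>
     T2 = {(0, h1 / 2, h2, m2), (0, h1 / 2, m2, A2), (h1 / 2, h1, h2, m2), (h1 / 2, h1, m2, A2)}\<rbrakk> \<Longrightarrow>
    edge_partition \<sigma>
      (T1 \<union> T2 \<union>
       {(h1, m1, h2, m2), (m1, A1, h2, m2), (h1, m1, m2, A2), (m1, A1, m2, A2)})"

(* True: diagonal from lower left to upper right; False: the other diagonal. *)
fun diagonal_split :: "bool \<Rightarrow> rectangle \<Rightarrow> (real^2) set set" where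
  "diagonal_split True (a, b, c, d) =
     {convex hull {pt a c, pt b d, pt b c}, convex hull {pt a c, pt b d, pt a d}}"
| "diagonal_split False (a, b, c, d) =
     {convex hull {pt b c, pt a d, pt a c}, convex hull {pt b c, pt a d, pt b d}}"

(* Reflections are admitted. This adds no patches: each of the families (d), (e), (f)
   is mapped to itself by a reflection (x to -x for (d) and (e); swapping x and y for (f)). *)
definition coordinate_rigid_motion :: "(real^2 \<Rightarrow> real^2) \<Rightarrow> bool" where
  "coordinate_rigid_motion \<phi> \<longleftrightarrow>
     (\<exists>a f. orthogonal_transformation f \<and>
            (\<forall>i. \<exists>j. f (axis i 1) = axis j 1 \<or> f (axis i 1) = - axis j 1) \<and>
            \<phi> = (\<lambda>x. a + f x))"

(* delta chooses the diagonal independently in each rectangle. *)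
definition triangulated_edge_patch :: "real \<Rightarrow> (real^2) set set \<Rightarrow> bool" where
  "triangulated_edge_patch \<sigma> \<P> \<longleftrightarrow>
     (\<exists>\<C> \<delta> \<phi>. edge_partition \<sigma> \<C> \<and> coordinate_rigid_motion \<phi> \<and>
        \<P> = (\<lambda>K. \<phi> ` K) ` (\<Union>R\<in>\<C>. diagonal_split (\<delta> R) R))"

definition poly_on :: "nat \<Rightarrow> (real^2) set \<Rightarrow> (real^2 \<Rightarrow> real) \<Rightarrow> bool" where
  "poly_on l K f \<longleftrightarrow>
     (\<exists>c :: nat \<Rightarrow> nat \<Rightarrow> real. \<forall>x\<in>K. f x = (\<Sum>i\<le>l. \<Sum>j\<le>l - i. c i j * (x $ 1) ^ i * (x $ 2) ^ j))"

(* Functions on omega are represented by total functions whose values off omega are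
   irrelevant; the nonzero elements are those that do not vanish identically on omega. *)
definition pressure_space :: "(real^2) set set \<Rightarrow> (real^2) set \<Rightarrow> (real^2 \<Rightarrow> real) set" where
  "pressure_space \<P> \<omega> =
     {q. continuous_on \<omega> q \<and> (\<forall>K\<in>\<P>. poly_on 1 K q) \<and> integral \<omega> q = 0}"

definition velocity_space :: "(real^2) set set \<Rightarrow> (real^2) set \<Rightarrow> (real^2 \<Rightarrow> real^2) set" where
  "velocity_space \<P> \<omega> =
     {v. continuous_on \<omega> v \<and> (\<forall>K\<in>\<P>. \<forall>i. poly_on 2 K (\<lambda>x. v x $ i)) \<and>
         (\<forall>x\<in>frontier \<omega>. v x = 0)}"

(* Elements of the velocity space are differentiable in the interior of each triangle, so
   the Jacobian below is the weak gradient off the (negligible) union of the edges. *)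
definition divergence :: "(real^2 \<Rightarrow> real^2) \<Rightarrow> real^2 \<Rightarrow> real" where
  "divergence v x = trace (jacobian v (at x))"

definition L2_norm_on :: "(real^2) set \<Rightarrow> (real^2 \<Rightarrow> real) \<Rightarrow> real" where
  "L2_norm_on \<omega> q = sqrt (integral \<omega> (\<lambda>x. (q x)\<^sup>2))"

(* The norm on the type of matrices is the Frobenius norm. *)
definition H1_seminorm_on :: "(real^2) set \<Rightarrow> (real^2 \<Rightarrow> real^2) \<Rightarrow> real" where
  "H1_seminorm_on \<omega> v = L2_norm_on \<omega> (\<lambda>x. norm (jacobian v (at x)))"

definition nonzero_on :: "'a set \<Rightarrow> ('a \<Rightarrow> 'b::zero) \<Rightarrow> bool" where
  "nonzero_on \<omega> f \<longleftrightarrow> (\<exists>x\<in>\<omega>. f x \<noteq> 0)"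

end

theory Submission
  imports Defs
begin

text \<open>
The pressure is measured against the simplest test velocities: the quadratic bubble of a single
interior edge, multiplied by a constant vector \<open>u\<close>. Such a bubble lives on the two triangles
\<open>K1\<close>, \<open>K2\<close> that share the edge, and it vanishes on the boundary of their union. Integrating its
divergence against \<open>q\<close> therefore produces \<open>- (1/12) (\<mu>1 (grad q|K1) \<bullet> u + \<mu>2 (grad q|K2) \<bullet> u)\<close> with
\<open>\<mu>i\<close> the area of \<open>Ki\<close>: a combination of differences of vertex values of \<open>q\<close>.

Two kinds of edges are used. For the diagonal of a cell and \<open>u\<close> vertical, the combination is the sum
of the vertical differences of \<open>q\<close> along the left and the right side of the cell, whichever diagonal
is chosen (\<open>diagonal_bubble_estimate\<close>). For the common vertical edge of two congruent cells lying side
by side, it is the vertical difference along this edge (\<open>edge_bubble_estimate\<close>). Both together control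
the vertical differences on all three vertical lines of the pair.

The aspect ratio enters only through the energy of the bubble, which for a cell of width \<open>w\<close> and
height \<open>h\<close> is comparable to \<open>w/h + h/w\<close>. In a flat cell, \<open>h \<le> \<kappa> w\<close>, the difference across the
short direction is controlled with a constant that depends on \<open>\<kappa>\<close> alone (\<open>scale_estimate\<close>),
in the scaling \<open>(difference) * sqrt (area) \<le> const * S\<close>, where \<open>S\<close> bounds the functional
\<open>v \<mapsto> \<integral> q div v / |v|\<close>. The difference across the long direction of a flat cell is not
controlled from inside the cell, but it need not be: on the shape-regular part of the patch all
differences are controlled (\<open>regular_pair\<close>), the flat cells have their long sides on that part, and
descending from there only crosses flat cells in the short direction (\<open>flat_pair\<close>). As the area
of a flat cell is at most a constant times that of a regular cell, the bounds on the regular part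
survive the passage to the scaling of the flat cells. Hence every vertex value differs from one
reference value \<open>q0\<close> by at most \<open>const * S\<close> divided by the square root of the area of the cell
(\<open>edge_patch_near\<close>), and as \<open>q\<close> has mean zero, its norm is at most that of \<open>q - q0\<close>, thus at
most \<open>const * S\<close> (\<open>norm_bound\<close>).
\<close>

section \<open>Barycentric coordinates and integrals of quadratics over a triangle\<close>

text \<open>With the vertex c as origin, l and m are the gradients of the barycentric coordinates
of a and b. Naming them by duality instead of by formulas keeps determinants out of the
calculations below.\<close>

definition dual_vectors :: "real^2 \<Rightarrow> real^2 \<Rightarrow> real^2 \<Rightarrow> real^2 \<Rightarrow> real^2 \<Rightarrow> bool" where
  "dual_vectors c a b l m \<longleftrightarrow>
     l \<bullet> (a - c) = 1 \<and> l \<bullet> (b - c) = 0 \<and> m \<bullet> (a - c) = 0 \<and> m \<bullet> (b - c) = 1"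

lemma dual_vectors_swap: "dual_vectors c a b l m \<Longrightarrow> dual_vectors c b a m l"
  by (auto simp: dual_vectors_def)

lemma dual_vectors_rotate: "dual_vectors c a b l m \<Longrightarrow> dual_vectors a b c m (- l - m)"
  by (auto simp: dual_vectors_def algebra_simps)

text \<open>A left inverse of a 2 by 2 matrix is a right inverse.\<close>

lemma dual_vectors_expand:
  assumes "dual_vectors c a b l m"
  shows "x = c + (l \<bullet> (x - c)) *\<^sub>R (a - c) + (m \<bullet> (x - c)) *\<^sub>R (b - c)"
proof -
  define A B where "A = a - c" and "B = b - c"
  have d: "l$1 * A$1 + l$2 * A$2 = 1" "l$1 * B$1 + l$2 * B$2 = 0"
    "m$1 * A$1 + m$2 * A$2 = 0" "m$1 * B$1 + m$2 * B$2 = 1"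
    using assms by (auto simp: dual_vectors_def A_def B_def inner_vec_def sum_2)
  have e: "A$1 * l$1 + B$1 * m$1 = 1" "A$1 * l$2 + B$1 * m$2 = 0"
    "A$2 * l$1 + B$2 * m$1 = 0" "A$2 * l$2 + B$2 * m$2 = 1"
    using d by algebra+
  have "y = (l \<bullet> y) *\<^sub>R A + (m \<bullet> y) *\<^sub>R B" for y
  proof -
    have "y$1 = (l$1 * y$1 + l$2 * y$2) * A$1 + (m$1 * y$1 + m$2 * y$2) * B$1"
      using e(1,2) by algebra
    moreover have "y$2 = (l$1 * y$1 + l$2 * y$2) * A$2 + (m$1 * y$1 + m$2 * y$2) * B$2"
      using e(3,4) by algebra
    ultimately show ?thesis
      by (simp add: vec_eq_iff forall_2 inner_vec_def sum_2)
  qed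
  from this[of "x - c"] show ?thesis
    by (simp add: A_def B_def algebra_simps)
qed

lemma triangle_eq:
  assumes "dual_vectors c a b l m"
  shows "convex hull {a, b, c} =
    {x. 0 \<le> l \<bullet> (x - c) \<and> 0 \<le> m \<bullet> (x - c) \<and> l \<bullet> (x - c) + m \<bullet> (x - c) \<le> 1}"
proof -
  have "{a, b, c} = {c, a, b}" by auto
  then have "convex hull {a, b, c} = {c + u *\<^sub>R (a - c) + v *\<^sub>R (b - c) | u v. 0 \<le> u \<and> 0 \<le> v \<and> u + v \<le> 1}"
    by (simp only: convex_hull_3_alt)
  also have "\<dots> = {x. 0 \<le> l \<bullet> (x - c) \<and> 0 \<le> m \<bullet> (x - c) \<and> l \<bullet> (x - c) + m \<bullet> (x - c) \<le> 1}"
    (is "?A = ?B")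
  proof
    show "?A \<subseteq> ?B"
      using assms by (auto simp: dual_vectors_def inner_add_right)
    show "?B \<subseteq> ?A"
      using dual_vectors_expand[OF assms] by blast
  qed
  finally show ?thesis .
qed

lemma has_integral_affine_preimage:
  fixes f :: "'a::euclidean_space \<Rightarrow> real"
  assumes "(f has_integral i) S" "bounded S" "r \<noteq> 0"
  shows "((\<lambda>x. f (r *\<^sub>R x + e)) has_integral i / \<bar>r\<bar> ^ DIM('a)) {x. r *\<^sub>R x + e \<in> S}"
proof -
  obtain u v where S: "S \<subseteq> cbox u v"
    using assms(2) bounded_subset_cbox_symmetric by blast
  have "((\<lambda>x. if x \<in> S then f x else 0) has_integral i) (cbox u v)"
    using S assms(1) by simp
  from has_integral_affinity[OF this assms(3), of e]
  have *: "((\<lambda>x. if x \<in> {x. r *\<^sub>R x + e \<in> S} then f (r *\<^sub>R x + e) else 0) has_integral i / \<bar>r\<bar> ^ DIM('a))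
      ((\<lambda>x. (1 / r) *\<^sub>R x + -((1 / r) *\<^sub>R e)) ` cbox u v)"
    by simp
  have "{x. r *\<^sub>R x + e \<in> S} \<subseteq> (\<lambda>x. (1 / r) *\<^sub>R x + -((1 / r) *\<^sub>R e)) ` cbox u v"
  proof
    fix x assume "x \<in> {x. r *\<^sub>R x + e \<in> S}"
    then have "r *\<^sub>R x + e \<in> cbox u v" using S by auto
    moreover have "x = (1 / r) *\<^sub>R (r *\<^sub>R x + e) + -((1 / r) *\<^sub>R e)"
      using assms(3) by (simp add: algebra_simps)
    ultimately show "x \<in> (\<lambda>x. (1 / r) *\<^sub>R x + -((1 / r) *\<^sub>R e)) ` cbox u v" by blast
  qed
  with * show ?thesis by (simp only: has_integral_restrict)
qed

lemma continuous_on_compact_integrable: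
  fixes f :: "'a::euclidean_space \<Rightarrow> real"
  assumes "compact S" "continuous_on S f"
  shows "f integrable_on S"
  using borel_integrable_compact[OF assms] set_borel_integral_eq_integral(1)[of S f]
  by (simp add: set_integrable_def)

lemma compact_triangle: "compact (convex hull {a, b, c :: real^2})"
  by (simp add: finite_imp_compact_convex_hull)

lemma negligible_level:
  fixes l :: "real^2"
  assumes "l \<noteq> 0" shows "negligible {x. l \<bullet> (x - c) = k}"
proof -
  have "{x. l \<bullet> (x - c) = k} = {x. l \<bullet> x = k + l \<bullet> c}" by (auto simp: inner_diff_right)
  then show ?thesis using negligible_hyperplane[of l "k + l \<bullet> c"] assms by simp
qed

lemma dual_vectors_nz:
  assumes "dual_vectors c a b l m"
  shows "l \<noteq> 0" "m \<noteq> 0" "l + m \<noteq> 0"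
proof -
  show "l \<noteq> 0" "m \<noteq> 0" using assms by (auto simp: dual_vectors_def)
  have "(l + m) \<bullet> (a - c) = 1" using assms by (simp add: dual_vectors_def inner_add_left)
  then show "l + m \<noteq> 0" by (metis inner_zero_left zero_neq_one)
qed

text \<open>The lines through the midpoints of the sides cut a triangle into four half-size
copies, three of them translated towards a vertex and the middle one rotated by 180 degrees.\<close>

lemma triangle_self_similar:
  fixes f :: "real^2 \<Rightarrow> real"
  assumes dual: "dual_vectors c a b l m" and f: "continuous_on UNIV f"
  defines "T \<equiv> convex hull {a, b, c}"
  shows "4 * integral T f =
    integral T (\<lambda>x. f ((1/2) *\<^sub>R x + (1/2) *\<^sub>R a)) + integral T (\<lambda>x. f ((1/2) *\<^sub>R x + (1/2) *\<^sub>R b))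
    + integral T (\<lambda>x. f ((1/2) *\<^sub>R x + (1/2) *\<^sub>R c)) + integral T (\<lambda>x. f ((-1/2) *\<^sub>R x + (1/2) *\<^sub>R (a + b + c)))"
proof -
  define s t where "s x = l \<bullet> (x - c)" and "t x = m \<bullet> (x - c)" for x
  have T: "T = {x. 0 \<le> s x \<and> 0 \<le> t x \<and> s x + t x \<le> 1}"
    using triangle_eq[OF dual] by (simp add: T_def s_def t_def)
  have cT: "compact T" unfolding T_def by (rule compact_triangle)
  have st: "s ((1/2) *\<^sub>R x + (1/2) *\<^sub>R a) = s x / 2 + 1/2" "t ((1/2) *\<^sub>R x + (1/2) *\<^sub>R a) = t x / 2"
    "s ((1/2) *\<^sub>R x + (1/2) *\<^sub>R b) = s x / 2" "t ((1/2) *\<^sub>R x + (1/2) *\<^sub>R b) = t x / 2 + 1/2"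
    "s ((1/2) *\<^sub>R x + (1/2) *\<^sub>R c) = s x / 2" "t ((1/2) *\<^sub>R x + (1/2) *\<^sub>R c) = t x / 2"
    "s ((1/2) *\<^sub>R (a + b + c) - (1/2) *\<^sub>R x) = 1/2 - s x / 2"
    "t ((1/2) *\<^sub>R (a + b + c) - (1/2) *\<^sub>R x) = 1/2 - t x / 2" for x
    using dual by (auto simp: dual_vectors_def s_def t_def inner_diff_right inner_add_right field_simps)
  define A B C M where "A = {x \<in> T. s x \<ge> 1/2}" and "B = {x \<in> T. t x \<ge> 1/2}"
    and "C = {x \<in> T. s x + t x \<le> 1/2}" and "M = {x \<in> T. s x \<le> 1/2 \<and> t x \<le> 1/2 \<and> s x + t x \<ge> 1/2}"
  have cont: "continuous_on UNIV s" "continuous_on UNIV t"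
    unfolding s_def t_def by (auto intro!: continuous_intros)
  have cl: "closed {x. s x \<ge> 1/2}" "closed {x. t x \<ge> 1/2}" "closed {x. s x + t x \<le> 1/2}"
      "closed {x. s x \<le> 1/2 \<and> t x \<le> 1/2 \<and> s x + t x \<ge> 1/2}"
    by (auto intro!: closed_Collect_le closed_Collect_conj continuous_intros cont)
  have comp: "compact A" "compact B" "compact C" "compact M"
    using compact_Int_closed[OF cT cl(1)] compact_Int_closed[OF cT cl(2)]
      compact_Int_closed[OF cT cl(3)] compact_Int_closed[OF cT cl(4)]
    by (auto simp: A_def B_def C_def M_def Int_def)
  have int: "f integrable_on S" if "compact S" for S
    by (rule continuous_on_compact_integrable[OF that continuous_on_subset[OF f]]) simp
  have pre: "integral T (\<lambda>x. f (r *\<^sub>R x + e)) = 4 * integral S f"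
    if "compact S" "r = 1/2 \<or> r = -1/2" "\<And>x. r *\<^sub>R x + e \<in> S \<longleftrightarrow> x \<in> T" for S r e
  proof -
    have "((\<lambda>x. f (r *\<^sub>R x + e)) has_integral integral S f / \<bar>r\<bar> ^ DIM(real^2)) {x. r *\<^sub>R x + e \<in> S}"
      using that(1,2) int[OF that(1)]
      by (intro has_integral_affine_preimage) (auto simp: compact_imp_bounded integrable_integral)
    moreover have "\<bar>r\<bar> ^ DIM(real^2) = 1/4"
      using that(2) by (elim disjE; hypsubst) (simp_all add: power2_eq_square)
    ultimately have "((\<lambda>x. f (r *\<^sub>R x + e)) has_integral integral S f / (1/4)) {x. r *\<^sub>R x + e \<in> S}"
      by (simp only:)
    then show ?thesis using that(3) by (simp add: integral_unique)
  qed
  have neg: "negligible {x. s x = 1/2}" "negligible {x. t x = 1/2}" "negligible {x. s x + t x = 1/2}"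
    using negligible_level[of l c "1/2"] negligible_level[of m c "1/2"] negligible_level[of "l + m" c "1/2"]
      dual_vectors_nz[OF dual]
    by (auto simp: s_def t_def inner_add_left)
  have "integral (A \<union> B) f = integral A f + integral B f"
    by (intro integral_Un int comp negligible_subset[OF neg(1)]) (auto simp: A_def B_def T)
  moreover have "integral (A \<union> B \<union> C) f = integral (A \<union> B) f + integral C f"
    by (intro integral_Un int comp compact_Un negligible_subset[OF neg(3)]) (auto simp: A_def B_def C_def T)
  moreover have "integral (A \<union> B \<union> C \<union> M) f = integral (A \<union> B \<union> C) f + integral M f"
    by (intro integral_Un int comp compact_Un negligible_subset[OF negligible_Un[OF negligible_Un[OF neg(1,2)] neg(3)]])
      (auto simp: A_def B_def C_def M_def T)
  moreover have "A \<union> B \<union> C \<union> M = T" by (auto simp: A_def B_def C_def M_def)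
  ultimately have "integral T f = integral A f + integral B f + integral C f + integral M f" by simp
  moreover have "integral T (\<lambda>x. f ((1/2) *\<^sub>R x + (1/2) *\<^sub>R a)) = 4 * integral A f"
    by (rule pre[OF comp(1)]) (auto simp: A_def T st)
  moreover have "integral T (\<lambda>x. f ((1/2) *\<^sub>R x + (1/2) *\<^sub>R b)) = 4 * integral B f"
    by (rule pre[OF comp(2)]) (auto simp: B_def T st)
  moreover have "integral T (\<lambda>x. f ((1/2) *\<^sub>R x + (1/2) *\<^sub>R c)) = 4 * integral C f"
    by (rule pre[OF comp(3)]) (auto simp: C_def T st)
  moreover have "integral T (\<lambda>x. f ((-1/2) *\<^sub>R x + (1/2) *\<^sub>R (a + b + c))) = 4 * integral M f"
    by (rule pre[OF comp(4)]) (auto simp: M_def T st)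
  ultimately show ?thesis by simp
qed

text \<open>For a barycentric coordinate u, self-similarity turns the integrals of u and of its
square into linear equations: u restricted to the four copies is u/2 (twice), (u+1)/2 and
(1-u)/2.\<close>

lemma triangle_barycentric_moments:
  assumes dual: "dual_vectors c a b l m"
  defines "T \<equiv> convex hull {a, b, c}"
  shows "integral T (\<lambda>x. l \<bullet> (x - c)) = measure lebesgue T / 3"
    and "integral T (\<lambda>x. (l \<bullet> (x - c))\<^sup>2) = measure lebesgue T / 6"
proof -
  define u where "u x = l \<bullet> (x - c)" for x
  have cT: "compact T" unfolding T_def by (rule compact_triangle)
  have cont: "continuous_on S u" for S
    unfolding u_def by (intro continuous_intros)
  have u: "u ((1/2) *\<^sub>R x + (1/2) *\<^sub>R a) = u x / 2 + 1/2"
    "u ((1/2) *\<^sub>R x + (1/2) *\<^sub>R b) = u x / 2"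
    "u ((1/2) *\<^sub>R x + (1/2) *\<^sub>R c) = u x / 2"
    "u ((-1/2) *\<^sub>R x + (1/2) *\<^sub>R (a + b + c)) = 1/2 - u x / 2" for x
    using dual by (auto simp: dual_vectors_def u_def inner_diff_right inner_add_right field_simps)
  have int: "f integrable_on T" if "continuous_on T f" for f :: "real^2 \<Rightarrow> real"
    by (rule continuous_on_compact_integrable[OF cT that])
  have i: "((\<lambda>x. 1) has_integral measure lebesgue T) T"
    using lmeasurable_compact[OF cT] lmeasure_integral int[of "\<lambda>x. 1"]
    by (metis continuous_on_const integrable_integral)
  have i1: "(u has_integral integral T u) T"
    by (intro integrable_integral int cont)
  have i2: "((\<lambda>x. (u x)\<^sup>2) has_integral integral T (\<lambda>x. (u x)\<^sup>2)) T"
    by (intro integrable_integral int continuous_intros cont)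
  have quad: "integral T (\<lambda>x. k0 + k1 * u x + k2 * (u x)\<^sup>2) =
      k0 * measure lebesgue T + k1 * integral T u + k2 * integral T (\<lambda>x. (u x)\<^sup>2)" for k0 k1 k2
    using has_integral_add[OF has_integral_add[OF has_integral_mult_right[OF i, of k0]
      has_integral_mult_right[OF i1, of k1]] has_integral_mult_right[OF i2, of k2]]
    by (simp add: integral_unique)
  have half: "integral T (\<lambda>x. u x / 2) = integral T u / 2"
    using quad[of 0 "1/2" 0] by simp
  have half1: "integral T (\<lambda>x. u x / 2 + 1/2) = integral T u / 2 + measure lebesgue T / 2"
    using quad[of "1/2" "1/2" 0] by (simp add: add.commute)
  have half2: "integral T (\<lambda>x. 1/2 - u x / 2) = measure lebesgue T / 2 - integral T u / 2"
    using quad[of "1/2" "-1/2" 0] by simp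
  have 1: "integral T u = measure lebesgue T / 3"
    using triangle_self_similar[OF dual cont] unfolding T_def[symmetric] u half half1 half2 by simp
  have sq: "(u x / 2 + 1/2)\<^sup>2 = 1/4 + 1/2 * u x + 1/4 * (u x)\<^sup>2"
    "(u x / 2)\<^sup>2 = 0 + 0 * u x + 1/4 * (u x)\<^sup>2"
    "(1/2 - u x / 2)\<^sup>2 = 1/4 + (-1/2) * u x + 1/4 * (u x)\<^sup>2" for x
    by (simp_all add: power2_eq_square field_simps)
  have "continuous_on UNIV (\<lambda>x. (u x)\<^sup>2)" by (intro continuous_intros cont)
  then have 2: "integral T (\<lambda>x. (u x)\<^sup>2) = measure lebesgue T / 6"
    using triangle_self_similar[OF dual, of "\<lambda>x. (u x)\<^sup>2"] unfolding T_def[symmetric] u sq quad by simp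
  show "integral T (\<lambda>x. l \<bullet> (x - c)) = measure lebesgue T / 3"
    "integral T (\<lambda>x. (l \<bullet> (x - c))\<^sup>2) = measure lebesgue T / 6"
    using 1 2 by (simp_all add: u_def[abs_def])
qed

text \<open>The mixed moment comes from polarization: the third barycentric coordinate 1 - s - t
has the same second moment as s and t.\<close>

lemma has_integral_triangle_quadratic:
  assumes dual: "dual_vectors c a b l m"
  defines "T \<equiv> convex hull {a, b, c}"
  defines "s \<equiv> \<lambda>x. l \<bullet> (x - c)" and "t \<equiv> \<lambda>x. m \<bullet> (x - c)"
  shows "((\<lambda>x. k + k1 * s x + k2 * t x + k3 * (s x)\<^sup>2 + k4 * (s x * t x) + k5 * (t x)\<^sup>2) has_integral
    measure lebesgue T * (k + (k1 + k2) / 3 + (k3 + k5) / 6 + k4 / 12)) T"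
proof -
  have cT: "compact T" unfolding T_def by (rule compact_triangle)
  have cont: "continuous_on S s" "continuous_on S t" for S
    unfolding s_def t_def by (auto intro!: continuous_intros)
  have int: "f integrable_on T" if "continuous_on T f" for f :: "real^2 \<Rightarrow> real"
    by (rule continuous_on_compact_integrable[OF cT that])
  have perm: "convex hull {b, a, c} = T" "convex hull {b, c, a} = T" "convex hull {c, a, b} = T"
    "convex hull {c, b, a} = T"
    unfolding T_def by (simp_all add: insert_commute)
  have i: "((\<lambda>x. 1) has_integral measure lebesgue T) T"
    using lmeasurable_compact[OF cT] lmeasure_integral int[of "\<lambda>x. 1"]
    by (metis continuous_on_const integrable_integral)
  have s1: "integral T s = measure lebesgue T / 3" and s2: "integral T (\<lambda>x. (s x)\<^sup>2) = measure lebesgue T / 6"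
    using triangle_barycentric_moments[OF dual] by (simp_all add: s_def T_def)
  have t1: "integral T t = measure lebesgue T / 3" and t2: "integral T (\<lambda>x. (t x)\<^sup>2) = measure lebesgue T / 6"
    using triangle_barycentric_moments[OF dual_vectors_swap[OF dual]] by (simp_all add: t_def perm)
  have w: "(- l - m) \<bullet> (x - a) = 1 - s x - t x" for x
    using dual by (simp add: dual_vectors_def s_def t_def algebra_simps)
  have w2: "integral T (\<lambda>x. (1 - s x - t x)\<^sup>2) = measure lebesgue T / 6"
    using triangle_barycentric_moments(2)[OF dual_vectors_swap[OF dual_vectors_rotate[OF dual]]]
    unfolding w perm by simp
  have hi: "(s has_integral measure lebesgue T / 3) T" "(t has_integral measure lebesgue T / 3) T"
    "((\<lambda>x. (s x)\<^sup>2) has_integral measure lebesgue T / 6) T" "((\<lambda>x. (t x)\<^sup>2) has_integral measure lebesgue T / 6) T"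
    "((\<lambda>x. (1 - s x - t x)\<^sup>2) has_integral measure lebesgue T / 6) T"
    using s1 s2 t1 t2 w2 unfolding has_integral_iff
    by (auto intro!: int continuous_on_power continuous_on_diff continuous_on_const cont simp del: power2_eq_square)
  have st_eq: "s x * t x = 1/2 * (1 - s x - t x)\<^sup>2 + s x + t x - 1/2 * (s x)\<^sup>2 - 1/2 * (t x)\<^sup>2 - 1/2 * 1" for x
    by (simp add: power2_eq_square field_simps)
  have st: "((\<lambda>x. s x * t x) has_integral measure lebesgue T / 12) T"
    unfolding st_eq
    using has_integral_diff[OF has_integral_diff[OF has_integral_diff[OF has_integral_add[OF has_integral_add[OF
      has_integral_mult_right[OF hi(5), of "1/2"] hi(1)] hi(2)] has_integral_mult_right[OF hi(3), of "1/2"]]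
      has_integral_mult_right[OF hi(4), of "1/2"]] has_integral_mult_right[OF i, of "1/2"]]
    by (rule has_integral_eq_rhs) simp
  have "((\<lambda>x. k * 1 + k1 * s x + k2 * t x + k3 * (s x)\<^sup>2 + k4 * (s x * t x) + k5 * (t x)\<^sup>2) has_integral
     k * measure lebesgue T + k1 * (measure lebesgue T / 3) + k2 * (measure lebesgue T / 3)
     + k3 * (measure lebesgue T / 6) + k4 * (measure lebesgue T / 12) + k5 * (measure lebesgue T / 6)) T"
    by (intro has_integral_add has_integral_mult_right hi i st)
  then show ?thesis
    by (rule has_integral_eq_rhs[OF has_integral_eq[rotated]]) (simp_all add: field_simps)
qed

section \<open>Edge bubbles\<close>

lemma simplex_sum_1: "(\<Sum>i\<le>1. \<Sum>j\<le>1 - i. F i j) = F 0 0 + F 0 1 + F (1::nat) (0::nat)" for F :: "nat \<Rightarrow> nat \<Rightarrow> real"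
proof -
  have "{..1::nat} = {0, 1}" by auto
  then show ?thesis by simp
qed
lemma simplex_sum_2: "(\<Sum>i\<le>2. \<Sum>j\<le>2 - i. F i j) = F 0 0 + F 0 1 + F 0 2 + F 1 0 + F 1 1 + F (2::nat) (0::nat)" for F :: "nat \<Rightarrow> nat \<Rightarrow> real"
proof -
  have "{..2::nat} = {0, 1, 2}" "{..1::nat} = {0, 1}" by auto
  then show ?thesis by simp
qed
lemma poly_on_1_iff:
  "poly_on 1 K f \<longleftrightarrow> (\<exists>k0 k1 k2. \<forall>x\<in>K. f x = k0 + k1 * x$1 + k2 * x$2)"
proof
  assume "poly_on 1 K f"
  then obtain c where "\<forall>x\<in>K. f x = (\<Sum>i\<le>1. \<Sum>j\<le>1 - i. c i j * (x $ 1) ^ i * (x $ 2) ^ j)"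
    unfolding poly_on_def by blast
  then have "\<forall>x\<in>K. f x = c 0 0 + c 1 0 * x$1 + c 0 1 * x$2"
    unfolding simplex_sum_1 by simp
  then show "\<exists>k0 k1 k2. \<forall>x\<in>K. f x = k0 + k1 * x$1 + k2 * x$2" by blast
next
  assume "\<exists>k0 k1 k2. \<forall>x\<in>K. f x = k0 + k1 * x$1 + k2 * x$2"
  then obtain k0 k1 k2 where k: "\<forall>x\<in>K. f x = k0 + k1 * x$1 + k2 * x$2" by blast
  show "poly_on 1 K f"
    unfolding poly_on_def simplex_sum_1
    by (rule exI[of _ "\<lambda>i j. if i = 0 then if j = 0 then k0 else k2 else k1"]) (simp add: k)
qed

lemma poly_on_2I:
  assumes "\<And>x. x \<in> K \<Longrightarrow> f x = k0 + k1 * x$1 + k2 * x$2 + k3 * (x$1)\<^sup>2 + k4 * (x$1 * x$2) + k5 * (x$2)\<^sup>2"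
  shows "poly_on 2 K f"
  unfolding poly_on_def simplex_sum_2
  by (rule exI[of _ "\<lambda>i j. if i = 0 then if j = 0 then k0 else if j = 1 then k2 else k5
       else if i = 1 then if j = 0 then k1 else k4 else k3"])
     (simp add: assms)
lemma poly_on_1_triangle:
  assumes dual: "dual_vectors c a b l m" and q: "poly_on 1 (convex hull {a, b, c}) q"
    and x: "x \<in> convex hull {a, b, c}"
  shows "q x = q c + (q a - q c) * (l \<bullet> (x - c)) + (q b - q c) * (m \<bullet> (x - c))"
proof -
  obtain k0 k1 k2 where k: "\<And>x. x \<in> convex hull {a, b, c} \<Longrightarrow> q x = k0 + k1 * x$1 + k2 * x$2"
    using q unfolding poly_on_1_iff by blast
  have "a \<in> convex hull {a, b, c}" "b \<in> convex hull {a, b, c}" "c \<in> convex hull {a, b, c}"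
    by (simp_all add: hull_inc)
  note k = k[OF this(1)] k[OF this(2)] k[OF this(3)] k[OF x]
  have "x$i = (c + (l \<bullet> (x - c)) *\<^sub>R (a - c) + (m \<bullet> (x - c)) *\<^sub>R (b - c))$i" for i
    using dual_vectors_expand[OF dual, of x] by simp
  then have "x$1 = c$1 + (l \<bullet> (x - c)) * (a$1 - c$1) + (m \<bullet> (x - c)) * (b$1 - c$1)"
    "x$2 = c$2 + (l \<bullet> (x - c)) * (a$2 - c$2) + (m \<bullet> (x - c)) * (b$2 - c$2)"
    by simp_all
  then show ?thesis using k by algebra
qed

lemma jacobian_scaled_direction:
  fixes g u :: "real^2"
  assumes "(\<phi> has_derivative (\<lambda>h. g \<bullet> h)) (at x)"
  shows "divergence (\<lambda>x. \<phi> x *\<^sub>R u) x = g \<bullet> u"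
    and "norm (jacobian (\<lambda>x. \<phi> x *\<^sub>R u) (at x)) = norm g * norm u"
proof -
  have "((\<lambda>x. \<phi> x *\<^sub>R u) has_derivative (\<lambda>h. (g \<bullet> h) *\<^sub>R u)) (at x)"
    using assms by (auto intro!: derivative_eq_intros)
  then have J: "jacobian (\<lambda>x. \<phi> x *\<^sub>R u) (at x) = (\<chi> i. u$i *\<^sub>R g)"
    by (auto simp: jacobian_def matrix_def vec_eq_iff inner_axis dest!: frechet_derivative_at[symmetric])
  show "divergence (\<lambda>x. \<phi> x *\<^sub>R u) x = g \<bullet> u"
    by (simp add: divergence_def J trace_def inner_vec_def mult.commute)
  show "norm (jacobian (\<lambda>x. \<phi> x *\<^sub>R u) (at x)) = norm g * norm u"
    by (simp add: J norm_vec_def[of "\<chi> i. u$i *\<^sub>R g"] norm_vec_def[of u] L2_set_right_distrib mult.commute)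
qed

text \<open>Two triangles on opposite sides of the edge ab whose union is convex at a and at b
(straight angles admitted): c2 has nonnegative barycentric coordinates with respect to a and b in
the first triangle, and a negative one with respect to c1.\<close>

locale triangle_pair =
  fixes a b c1 c2 l1 m1 l2 m2 :: "real^2"
  assumes dual1: "dual_vectors c1 a b l1 m1" and dual2: "dual_vectors c2 a b l2 m2"
    and convex_position: "0 \<le> l1 \<bullet> (c2 - c1)" "0 \<le> m1 \<bullet> (c2 - c1)" "1 < l1 \<bullet> (c2 - c1) + m1 \<bullet> (c2 - c1)"
begin

definition "K1 = convex hull {a, b, c1}"
definition "K2 = convex hull {a, b, c2}"
definition "s1 x = l1 \<bullet> (x - c1)"
definition "t1 x = m1 \<bullet> (x - c1)"
definition "s2 x = l2 \<bullet> (x - c2)"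
definition "t2 x = m2 \<bullet> (x - c2)"

text \<open>Convexity makes the piecewise affine hat function of a on the two triangles the
minimum of its two affine pieces, so a single formula on the whole plane gives continuity and
support of the bubble at once.\<close>

definition bubble :: "real^2 \<Rightarrow> real" where
  "bubble x = max 0 (min (s1 x) (s2 x)) * max 0 (min (t1 x) (t2 x))"

lemma K1_eq: "K1 = {x. 0 \<le> s1 x \<and> 0 \<le> t1 x \<and> s1 x + t1 x \<le> 1}"
  and K2_eq: "K2 = {x. 0 \<le> s2 x \<and> 0 \<le> t2 x \<and> s2 x + t2 x \<le> 1}"
  using triangle_eq[OF dual1] triangle_eq[OF dual2]
  by (simp_all add: K1_def K2_def s1_def t1_def s2_def t2_def)

lemma second_coordinates:
  "s2 x = s1 x + (1 - s1 x - t1 x) * s2 c1" "t2 x = t1 x + (1 - s1 x - t1 x) * t2 c1"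
proof -
  note d = dual2[unfolded dual_vectors_def]
  have x: "x - c2 = (c1 - c2) + s1 x *\<^sub>R (a - c2 - (c1 - c2)) + t1 x *\<^sub>R (b - c2 - (c1 - c2))"
    using dual_vectors_expand[OF dual1, of x] by (simp add: s1_def t1_def algebra_simps)
  show "s2 x = s1 x + (1 - s1 x - t1 x) * s2 c1"
    unfolding s2_def by (subst x, simp only: inner_add_right inner_diff_right[of _ "a - c2"] inner_diff_right[of _ "b - c2"]
      inner_scaleR_right, use d in \<open>simp add: algebra_simps\<close>)
  show "t2 x = t1 x + (1 - s1 x - t1 x) * t2 c1"
    unfolding t2_def by (subst x, simp only: inner_add_right inner_diff_right[of _ "a - c2"] inner_diff_right[of _ "b - c2"]
      inner_scaleR_right, use d in \<open>simp add: algebra_simps\<close>)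
qed

lemma c1_beyond: "0 \<le> s2 c1" "0 \<le> t2 c1" "1 < s2 c1 + t2 c1"
proof -
  define p r where "p = s1 c2" and "r = t1 c2"
  have pr: "0 \<le> p" "0 \<le> r" "1 < p + r" using convex_position by (auto simp: p_def r_def s1_def t1_def)
  have z: "s2 c2 = 0" "t2 c2 = 0" by (auto simp: s2_def t2_def)
  have "p = (p + r - 1) * s2 c1" "r = (p + r - 1) * t2 c1"
    using second_coordinates[of c2] z by (auto simp: p_def r_def algebra_simps)
  then have e: "s2 c1 = p / (p + r - 1)" "t2 c1 = r / (p + r - 1)" using pr by (auto simp: field_simps)
  show "0 \<le> s2 c1" "0 \<le> t2 c1" unfolding e using pr by auto
  have "s2 c1 + t2 c1 = (p + r) / (p + r - 1)" unfolding e by (simp add: add_divide_distrib)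
  also have "\<dots> > 1" using pr by (simp add: field_simps)
  finally show "1 < s2 c1 + t2 c1" .
qed

lemma third_coordinate: "1 - s2 x - t2 x = - ((s2 c1 + t2 c1 - 1) * (1 - s1 x - t1 x))"
  using second_coordinates[of x] by algebra

text \<open>The difference of the two affine pieces of a hat function is a nonnegative multiple
of the barycentric coordinate of c1, which changes sign across the edge.\<close>

lemma order_coordinates:
  "s1 x + t1 x \<le> 1 \<Longrightarrow> s1 x \<le> s2 x" "s1 x + t1 x \<le> 1 \<Longrightarrow> t1 x \<le> t2 x"
  "s1 x + t1 x \<ge> 1 \<Longrightarrow> s2 x \<le> s1 x" "s1 x + t1 x \<ge> 1 \<Longrightarrow> t2 x \<le> t1 x"
  using second_coordinates[of x] c1_beyond(1,2)
    mult_nonneg_nonneg[of "1 - s1 x - t1 x" "s2 c1"] mult_nonneg_nonneg[of "1 - s1 x - t1 x" "t2 c1"]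
    mult_nonpos_nonneg[of "1 - s1 x - t1 x" "s2 c1"] mult_nonpos_nonneg[of "1 - s1 x - t1 x" "t2 c1"]
  by auto

lemma side_iff: "s2 x + t2 x \<le> 1 \<longleftrightarrow> s1 x + t1 x \<ge> 1" "s2 x + t2 x < 1 \<longleftrightarrow> s1 x + t1 x > 1"
proof -
  have "s2 c1 + t2 c1 - 1 > 0" using c1_beyond by simp
  then show "s2 x + t2 x \<le> 1 \<longleftrightarrow> s1 x + t1 x \<ge> 1" "s2 x + t2 x < 1 \<longleftrightarrow> s1 x + t1 x > 1"
    using third_coordinate[of x] zero_le_mult_iff[of "s2 c1 + t2 c1 - 1" "s1 x + t1 x - 1"]
      zero_less_mult_iff[of "s2 c1 + t2 c1 - 1" "s1 x + t1 x - 1"]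
    by (auto simp: algebra_simps)
qed

lemma bubble_K1: "x \<in> K1 \<Longrightarrow> bubble x = s1 x * t1 x"
  using order_coordinates[of x] by (auto simp: K1_eq bubble_def)

lemma bubble_K2: "x \<in> K2 \<Longrightarrow> bubble x = s2 x * t2 x"
  using order_coordinates[of x] side_iff[of x] by (auto simp: K2_eq bubble_def)

lemma bubble_nonzero_iff: "bubble x \<noteq> 0 \<longleftrightarrow> 0 < s1 x \<and> 0 < t1 x \<and> 0 < s2 x \<and> 0 < t2 x"
  by (auto simp: bubble_def max_def min_def)

lemma bubble_support: "bubble x \<noteq> 0 \<Longrightarrow> x \<in> K1 \<union> K2"
  using side_iff[of x] unfolding bubble_nonzero_iff K1_eq K2_eq by auto

lemma continuous_coordinates:
  "continuous_on S s1" "continuous_on S t1" "continuous_on S s2" "continuous_on S t2"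
  unfolding s1_def t1_def s2_def t2_def by (auto intro!: continuous_intros)

lemma continuous_bubble: "continuous_on S bubble"
  unfolding bubble_def by (intro continuous_intros continuous_coordinates)

text \<open>Off these lines the bubble is differentiable.\<close>

definition "exceptional = {x. s1 x = 0} \<union> {x. t1 x = 0} \<union> {x. s1 x + t1 x = 1} \<union> {x. s2 x = 0} \<union> {x. t2 x = 0}"

lemma negligible_exceptional: "negligible exceptional"
proof -
  have "{x. s1 x + t1 x = 1} = {x. (l1 + m1) \<bullet> (x - c1) = 1}"
    by (simp add: s1_def t1_def inner_add_left)
  then show ?thesis
    using dual_vectors_nz[OF dual1] dual_vectors_nz[OF dual2]
    by (auto simp: exceptional_def s1_def t1_def s2_def t2_def intro!: negligible_level)
qed

lemma bubble_derivative:
  shows "\<lbrakk>x \<in> K1; x \<notin> exceptional\<rbrakk> \<Longrightarrow> (bubble has_derivative (\<lambda>h. (s1 x *\<^sub>R m1 + t1 x *\<^sub>R l1) \<bullet> h)) (at x)"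
    and "\<lbrakk>x \<in> K2; x \<notin> exceptional\<rbrakk> \<Longrightarrow> (bubble has_derivative (\<lambda>h. (s2 x *\<^sub>R m2 + t2 x *\<^sub>R l2) \<bullet> h)) (at x)"
    and "x \<notin> K1 \<union> K2 \<Longrightarrow> (bubble has_derivative (\<lambda>h. 0 \<bullet> h)) (at x)"
proof -
  have o1: "open {x. 0 < s1 x \<and> 0 < t1 x \<and> s1 x + t1 x < 1}"
    and o2: "open {x. 0 < s2 x \<and> 0 < t2 x \<and> s2 x + t2 x < 1}"
    by (auto intro!: open_Collect_less open_Collect_conj continuous_intros continuous_coordinates)
  have d1: "((\<lambda>x. s1 x * t1 x) has_derivative (\<lambda>h. (s1 x *\<^sub>R m1 + t1 x *\<^sub>R l1) \<bullet> h)) (at x)"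
    unfolding s1_def t1_def by (auto intro!: derivative_eq_intros simp: inner_add_left algebra_simps)
  have d2: "((\<lambda>x. s2 x * t2 x) has_derivative (\<lambda>h. (s2 x *\<^sub>R m2 + t2 x *\<^sub>R l2) \<bullet> h)) (at x)"
    unfolding s2_def t2_def by (auto intro!: derivative_eq_intros simp: inner_add_left algebra_simps)
  show "(bubble has_derivative (\<lambda>h. (s1 x *\<^sub>R m1 + t1 x *\<^sub>R l1) \<bullet> h)) (at x)" if "x \<in> K1" "x \<notin> exceptional"
    by (rule has_derivative_transform_within_open[OF d1 o1])
      (use that in \<open>auto simp: K1_eq exceptional_def intro!: bubble_K1[symmetric]\<close>)
  show "(bubble has_derivative (\<lambda>h. (s2 x *\<^sub>R m2 + t2 x *\<^sub>R l2) \<bullet> h)) (at x)" if "x \<in> K2" "x \<notin> exceptional"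
    by (rule has_derivative_transform_within_open[OF d2 o2])
      (use that side_iff[of x] in \<open>auto simp: K2_eq exceptional_def intro!: bubble_K2[symmetric]\<close>)
  have "compact (K1 \<union> K2)" unfolding K1_def K2_def by (intro compact_Un compact_triangle)
  then have o3: "open (- (K1 \<union> K2))" using compact_imp_closed open_Compl by blast
  show "(bubble has_derivative (\<lambda>h. 0 \<bullet> h)) (at x)" if "x \<notin> K1 \<union> K2"
    by (rule has_derivative_transform_within_open[OF _ o3, where f="\<lambda>x. 0"])
      (use that bubble_support in \<open>auto simp: \<close>)
qed

lemma has_integral_piecewise:
  fixes G :: "real^2 \<Rightarrow> real"
  assumes "(F1 has_integral i1) K1" "(F2 has_integral i2) K2" "K1 \<union> K2 \<subseteq> \<omega>"
    and G1: "\<And>x. x \<in> K1 \<Longrightarrow> x \<notin> exceptional \<Longrightarrow> G x = F1 x" and G2: "\<And>x. x \<in> K2 \<Longrightarrow> x \<notin> exceptional \<Longrightarrow> G x = F2 x"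
    and G0: "\<And>x. x \<notin> K1 \<union> K2 \<Longrightarrow> G x = 0"
  shows "(G has_integral i1 + i2) \<omega>"
proof -
  have "(G has_integral i1) K1" "(G has_integral i2) K2"
    using has_integral_spike[OF negligible_exceptional _ assms(1), of G]
      has_integral_spike[OF negligible_exceptional _ assms(2), of G] G1 G2 by auto
  moreover have "K1 \<inter> K2 \<subseteq> exceptional"
    using side_iff by (auto simp: K1_eq K2_eq exceptional_def intro: antisym)
  ultimately have "(G has_integral i1 + i2) (K1 \<union> K2)"
    using has_integral_Un negligible_subset[OF negligible_exceptional] by blast
  then have "((\<lambda>x. if x \<in> K1 \<union> K2 then G x else 0) has_integral i1 + i2) \<omega>"
    using assms(3) by (simp only: has_integral_restrict)
  moreover have "(\<lambda>x. if x \<in> K1 \<union> K2 then G x else 0) = G"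
    using G0 by auto
  ultimately show ?thesis by simp
qed

definition "\<mu>1 = measure lebesgue K1"
definition "\<mu>2 = measure lebesgue K2"

text \<open>Up to the factor 1/12, the integral of q times the divergence of the bubble in
direction u, for q affine on both triangles.\<close>

definition moment :: "(real^2 \<Rightarrow> real) \<Rightarrow> real^2 \<Rightarrow> real" where
  "moment q u =
    \<mu>1 * (q c1 * (l1 \<bullet> u + m1 \<bullet> u) + q a * (l1 \<bullet> u + 2 * (m1 \<bullet> u)) + q b * (2 * (l1 \<bullet> u) + m1 \<bullet> u))
    + \<mu>2 * (q c2 * (l2 \<bullet> u + m2 \<bullet> u) + q a * (l2 \<bullet> u + 2 * (m2 \<bullet> u)) + q b * (2 * (l2 \<bullet> u) + m2 \<bullet> u))"

definition energy :: real where
  "energy = \<mu>1 * (l1 \<bullet> l1 + l1 \<bullet> m1 + m1 \<bullet> m1) + \<mu>2 * (l2 \<bullet> l2 + l2 \<bullet> m2 + m2 \<bullet> m2)"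

lemma bubble_divergence_integral:
  assumes "poly_on 1 K1 q" "poly_on 1 K2 q" "K1 \<union> K2 \<subseteq> \<omega>"
  shows "((\<lambda>x. q x * divergence (\<lambda>x. bubble x *\<^sub>R u) x) has_integral moment q u / 12) \<omega>"
proof -
  define F1 where "F1 x = 0 + (q c1 * (m1 \<bullet> u)) * s1 x + (q c1 * (l1 \<bullet> u)) * t1 x
    + ((q a - q c1) * (m1 \<bullet> u)) * (s1 x)\<^sup>2 + ((q a - q c1) * (l1 \<bullet> u) + (q b - q c1) * (m1 \<bullet> u)) * (s1 x * t1 x)
    + ((q b - q c1) * (l1 \<bullet> u)) * (t1 x)\<^sup>2" for x
  define F2 where "F2 x = 0 + (q c2 * (m2 \<bullet> u)) * s2 x + (q c2 * (l2 \<bullet> u)) * t2 x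
    + ((q a - q c2) * (m2 \<bullet> u)) * (s2 x)\<^sup>2 + ((q a - q c2) * (l2 \<bullet> u) + (q b - q c2) * (m2 \<bullet> u)) * (s2 x * t2 x)
    + ((q b - q c2) * (l2 \<bullet> u)) * (t2 x)\<^sup>2" for x
  note i1 = has_integral_triangle_quadratic[OF dual1, folded K1_def, folded \<mu>1_def s1_def t1_def,
      of 0 "q c1 * (m1 \<bullet> u)" "q c1 * (l1 \<bullet> u)" "(q a - q c1) * (m1 \<bullet> u)"
      "(q a - q c1) * (l1 \<bullet> u) + (q b - q c1) * (m1 \<bullet> u)" "(q b - q c1) * (l1 \<bullet> u)", folded F1_def]
  note i2 = has_integral_triangle_quadratic[OF dual2, folded K2_def, folded \<mu>2_def s2_def t2_def,
      of 0 "q c2 * (m2 \<bullet> u)" "q c2 * (l2 \<bullet> u)" "(q a - q c2) * (m2 \<bullet> u)"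
      "(q a - q c2) * (l2 \<bullet> u) + (q b - q c2) * (m2 \<bullet> u)" "(q b - q c2) * (l2 \<bullet> u)", folded F2_def]
  note q1 = poly_on_1_triangle[OF dual1, folded K1_def, folded s1_def t1_def, OF assms(1)]
  note q2 = poly_on_1_triangle[OF dual2, folded K2_def, folded s2_def t2_def, OF assms(2)]
  note div = jacobian_scaled_direction(1)[OF bubble_derivative(1), of _ u] jacobian_scaled_direction(1)[OF bubble_derivative(2), of _ u]
    jacobian_scaled_direction(1)[OF bubble_derivative(3), of _ u]
  have "((\<lambda>x. q x * divergence (\<lambda>x. bubble x *\<^sub>R u) x) has_integral
     \<mu>1 * (0 + ((q c1 * (m1 \<bullet> u)) + (q c1 * (l1 \<bullet> u))) / 3 + (((q a - q c1) * (m1 \<bullet> u)) + ((q b - q c1) * (l1 \<bullet> u))) / 6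
       + ((q a - q c1) * (l1 \<bullet> u) + (q b - q c1) * (m1 \<bullet> u)) / 12)
     + \<mu>2 * (0 + ((q c2 * (m2 \<bullet> u)) + (q c2 * (l2 \<bullet> u))) / 3 + (((q a - q c2) * (m2 \<bullet> u)) + ((q b - q c2) * (l2 \<bullet> u))) / 6
       + ((q a - q c2) * (l2 \<bullet> u) + (q b - q c2) * (m2 \<bullet> u)) / 12)) \<omega>"
  proof (rule has_integral_piecewise[OF i1 i2 assms(3)])
    show "q x * divergence (\<lambda>x. bubble x *\<^sub>R u) x = F1 x" if "x \<in> K1" "x \<notin> exceptional" for x
      unfolding div(1)[OF that] q1[OF that(1)] F1_def inner_add_left inner_scaleR_left
      by (simp add: power2_eq_square algebra_simps)
    show "q x * divergence (\<lambda>x. bubble x *\<^sub>R u) x = F2 x" if "x \<in> K2" "x \<notin> exceptional" for x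
      unfolding div(2)[OF that] q2[OF that(1)] F2_def inner_add_left inner_scaleR_left
      by (simp add: power2_eq_square algebra_simps)
  qed (simp add: div(3))
  then show ?thesis
    by (rule has_integral_eq_rhs) (simp add: moment_def field_simps)
qed

lemma bubble_energy_integral:
  fixes u :: "real^2"
  assumes "K1 \<union> K2 \<subseteq> \<omega>"
  shows "((\<lambda>x. (norm (jacobian (\<lambda>x. bubble x *\<^sub>R u) (at x)))\<^sup>2) has_integral (norm u)\<^sup>2 * energy / 6) \<omega>"
proof -
  define F1 where "F1 x = 0 + 0 * s1 x + 0 * t1 x + ((norm u)\<^sup>2 * (m1 \<bullet> m1)) * (s1 x)\<^sup>2
     + ((norm u)\<^sup>2 * 2 * (l1 \<bullet> m1)) * (s1 x * t1 x) + ((norm u)\<^sup>2 * (l1 \<bullet> l1)) * (t1 x)\<^sup>2" for x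
  define F2 where "F2 x = 0 + 0 * s2 x + 0 * t2 x + ((norm u)\<^sup>2 * (m2 \<bullet> m2)) * (s2 x)\<^sup>2
     + ((norm u)\<^sup>2 * 2 * (l2 \<bullet> m2)) * (s2 x * t2 x) + ((norm u)\<^sup>2 * (l2 \<bullet> l2)) * (t2 x)\<^sup>2" for x
  note i1 = has_integral_triangle_quadratic[OF dual1, folded K1_def, folded \<mu>1_def s1_def t1_def,
      of 0 0 0 "(norm u)\<^sup>2 * (m1 \<bullet> m1)" "(norm u)\<^sup>2 * 2 * (l1 \<bullet> m1)" "(norm u)\<^sup>2 * (l1 \<bullet> l1)", folded F1_def]
  note i2 = has_integral_triangle_quadratic[OF dual2, folded K2_def, folded \<mu>2_def s2_def t2_def,
      of 0 0 0 "(norm u)\<^sup>2 * (m2 \<bullet> m2)" "(norm u)\<^sup>2 * 2 * (l2 \<bullet> m2)" "(norm u)\<^sup>2 * (l2 \<bullet> l2)", folded F2_def]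
  note nrm = jacobian_scaled_direction(2)[OF bubble_derivative(1), of _ u] jacobian_scaled_direction(2)[OF bubble_derivative(2), of _ u]
    jacobian_scaled_direction(2)[OF bubble_derivative(3), of _ u]
  have "((\<lambda>x. (norm (jacobian (\<lambda>x. bubble x *\<^sub>R u) (at x)))\<^sup>2) has_integral
    \<mu>1 * (0 + (0 + 0) / 3 + ((norm u)\<^sup>2 * (m1 \<bullet> m1) + (norm u)\<^sup>2 * (l1 \<bullet> l1)) / 6 + (norm u)\<^sup>2 * 2 * (l1 \<bullet> m1) / 12)
    + \<mu>2 * (0 + (0 + 0) / 3 + ((norm u)\<^sup>2 * (m2 \<bullet> m2) + (norm u)\<^sup>2 * (l2 \<bullet> l2)) / 6 + (norm u)\<^sup>2 * 2 * (l2 \<bullet> m2) / 12)) \<omega>"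
  proof (rule has_integral_piecewise[OF i1 i2 assms])
    show "(norm (jacobian (\<lambda>x. bubble x *\<^sub>R u) (at x)))\<^sup>2 = F1 x" if "x \<in> K1" "x \<notin> exceptional" for x
      unfolding nrm(1)[OF that] F1_def power_mult_distrib power2_norm_eq_inner[of "_ + _"]
      by (simp add: inner_add_left inner_add_right inner_commute[of m1 l1] power2_eq_square algebra_simps)
    show "(norm (jacobian (\<lambda>x. bubble x *\<^sub>R u) (at x)))\<^sup>2 = F2 x" if "x \<in> K2" "x \<notin> exceptional" for x
      unfolding nrm(2)[OF that] F2_def power_mult_distrib power2_norm_eq_inner[of "_ + _"]
      by (simp add: inner_add_left inner_add_right inner_commute[of m2 l2] power2_eq_square algebra_simps)
  qed (simp add: nrm(3))
  then show ?thesis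
    by (rule has_integral_eq_rhs) (simp add: energy_def field_simps)
qed

end

section \<open>Testing a pressure against the bubbles\<close>

lemma measure_triangle:
  "measure lebesgue (convex hull {a, b, c :: real^2}) =
    \<bar>(a - c)$1 * (b - c)$2 - (a - c)$2 * (b - c)$1\<bar> / 2"
proof -
  have e: "{a, b, c} = {c, b, a}" by auto
  have "closed (convex hull {a, b, c})" using compact_triangle compact_imp_closed by blast
  then have "measure lebesgue (convex hull {a, b, c}) = measure lborel (convex hull {a, b, c})"
    by (intro measure_completion) auto
  then show ?thesis
    unfolding e content_triangle by (simp add: mult.commute)
qed

lemma measure_triangle_pos:
  assumes "dual_vectors c a b l m"
  shows "0 < measure lebesgue (convex hull {a, b, c})"
proof -
  define A B where "A = a - c" and "B = b - c"
  have "l$1 * A$1 + l$2 * A$2 = 1" "l$1 * B$1 + l$2 * B$2 = 0"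
    "m$1 * A$1 + m$2 * A$2 = 0" "m$1 * B$1 + m$2 * B$2 = 1"
    using assms by (auto simp: dual_vectors_def A_def B_def inner_vec_def sum_2)
  then have "(A$1 * B$2 - A$2 * B$1) * (l$1 * m$2 - l$2 * m$1) = 1" by algebra
  then show ?thesis unfolding measure_triangle A_def B_def by auto
qed

lemma quadratic_form_pos:
  fixes l m :: "real^2"
  assumes "l \<noteq> 0"
  shows "0 < l \<bullet> l + l \<bullet> m + m \<bullet> m"
proof -
  have "l \<bullet> l + l \<bullet> m + m \<bullet> m = ((l + m) \<bullet> (l + m) + l \<bullet> l + m \<bullet> m) / 2"
    by (simp add: inner_add_left inner_add_right inner_commute)
  moreover have "0 < l \<bullet> l" using assms by simp
  ultimately show ?thesis
    using add_pos_nonneg[OF add_nonneg_pos[OF inner_ge_zero[of "l + m"] \<open>0 < l \<bullet> l\<close>] inner_ge_zero[of m]] by simp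
qed

text \<open>If this fails for S, some velocity makes the quotient of the inf-sup condition exceed
S divided by the norm of q. Division by zero yields 0, hence the restriction to velocities of
positive seminorm.\<close>

definition pressure_controlled :: "(real^2) set set \<Rightarrow> (real^2 \<Rightarrow> real) \<Rightarrow> real \<Rightarrow> bool" where
  "pressure_controlled \<P> q S \<longleftrightarrow>
     (\<forall>v\<in>velocity_space \<P> (\<Union>\<P>). nonzero_on (\<Union>\<P>) v \<longrightarrow> 0 < H1_seminorm_on (\<Union>\<P>) v \<longrightarrow>
        integral (\<Union>\<P>) (\<lambda>x. q x * divergence v x) \<le> S * H1_seminorm_on (\<Union>\<P>) v)"

context triangle_pair
begin

text \<open>The bubble vanishes on the frontier of the domain because the set where it does not
vanish is open and contained in the domain.\<close>

lemma bubble_velocity: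
  assumes "K1 \<in> \<P>" "K2 \<in> \<P>"
    and others: "\<And>K x. \<lbrakk>K \<in> \<P>; K \<noteq> K1; K \<noteq> K2; x \<in> K\<rbrakk> \<Longrightarrow> bubble x = 0"
  shows "(\<lambda>x. bubble x *\<^sub>R u) \<in> velocity_space \<P> (\<Union>\<P>)"
proof -
  have quad: "poly_on 2 K (\<lambda>x. (l \<bullet> (x - c)) * (m \<bullet> (x - c)) * k)" for K and l m c :: "real^2" and k
    by (rule poly_on_2I[of _ _ "(l \<bullet> c) * (m \<bullet> c) * k" "- ((l \<bullet> c) * m$1 + (m \<bullet> c) * l$1) * k"
          "- ((l \<bullet> c) * m$2 + (m \<bullet> c) * l$2) * k" "l$1 * m$1 * k" "(l$1 * m$2 + l$2 * m$1) * k" "l$2 * m$2 * k"])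
       (simp add: inner_diff_right inner_vec_def sum_2 power2_eq_square algebra_simps)
  have "poly_on 2 K (\<lambda>x. (bubble x *\<^sub>R u) $ i)" if "K \<in> \<P>" for K i
  proof -
    consider "K = K1" | "K = K2" | "K \<noteq> K1" "K \<noteq> K2" by blast
    then show ?thesis
    proof cases
      case 1
      then show ?thesis
        using quad[of K l1 c1 m1 "u$i"] bubble_K1 by (simp add: poly_on_def s1_def t1_def)
    next
      case 2
      then show ?thesis
        using quad[of K l2 c2 m2 "u$i"] bubble_K2 by (simp add: poly_on_def s2_def t2_def)
    next
      case 3
      then show ?thesis
        using others[OF that] by (intro poly_on_2I[of _ _ 0 0 0 0 0 0]) simp
    qed
  qed
  moreover have "bubble x = 0" if "x \<in> frontier (\<Union>\<P>)" for x
  proof (rule ccontr)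
    assume "bubble x \<noteq> 0"
    moreover have "open {x. bubble x \<noteq> 0}"
      by (intro open_Collect_neq continuous_bubble continuous_intros)
    moreover have "{x. bubble x \<noteq> 0} \<subseteq> \<Union>\<P>" using bubble_support assms(1,2) by blast
    ultimately have "x \<in> interior (\<Union>\<P>)" by (auto intro: interiorI)
    then show False using that by (simp add: frontier_def)
  qed
  ultimately show ?thesis
    by (auto simp: velocity_space_def intro!: continuous_intros continuous_bubble)
qed

lemma energy_pos: "0 < energy"
proof -
  have "0 < \<mu>1" "0 < \<mu>2"
    using measure_triangle_pos[OF dual1] measure_triangle_pos[OF dual2]
    by (simp_all add: \<mu>1_def \<mu>2_def K1_def K2_def)
  then show ?thesis
    unfolding energy_def
    by (intro add_pos_pos mult_pos_pos quadratic_form_pos dual_vectors_nz[OF dual1] dual_vectors_nz[OF dual2])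
qed

lemma moment_minus: "moment q (- u) = - moment q u"
  unfolding moment_def inner_minus_right by algebra

lemma moment_bound:
  assumes K: "K1 \<in> \<P>" "K2 \<in> \<P>"
    and others: "\<And>K x. \<lbrakk>K \<in> \<P>; K \<noteq> K1; K \<noteq> K2; x \<in> K\<rbrakk> \<Longrightarrow> bubble x = 0"
    and q: "\<And>K. K \<in> \<P> \<Longrightarrow> poly_on 1 K q" and ctrl: "pressure_controlled \<P> q S" and "norm u = 1"
  shows "\<bar>moment q u\<bar> \<le> 12 * S * sqrt (energy / 6)"
proof -
  have sub: "K1 \<union> K2 \<subseteq> \<Union>\<P>" using K by blast
  have "moment q u \<le> 12 * S * sqrt (energy / 6)" if u: "norm u = 1" for u
  proof -
    define v where "v = (\<lambda>x. bubble x *\<^sub>R u)"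
    have v: "v \<in> velocity_space \<P> (\<Union>\<P>)"
      unfolding v_def by (rule bubble_velocity[OF K others])
    have H1: "H1_seminorm_on (\<Union>\<P>) v = sqrt (energy / 6)"
      using bubble_energy_integral[OF sub, of u] u
      by (simp add: H1_seminorm_on_def L2_norm_on_def v_def integral_unique)
    have d: "dual_vectors c1 a b l1 m1" "dual_vectors c2 a b l2 m2" by (rule dual1 dual2)+
    define x where "x = (1/2) *\<^sub>R (a + b)"
    have "s1 x = 1/2" "t1 x = 1/2"
      using d by (auto simp: s1_def t1_def x_def dual_vectors_def inner_diff_right inner_add_right field_simps)
    then have x: "x \<in> K1" "bubble x \<noteq> 0"
      using bubble_K1[of x] by (auto simp: K1_eq)
    then have nz: "nonzero_on (\<Union>\<P>) v" using K(1) u by (auto simp: nonzero_on_def v_def)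
    have "0 < H1_seminorm_on (\<Union>\<P>) v" using H1 energy_pos by simp
    then have "integral (\<Union>\<P>) (\<lambda>x. q x * divergence v x) \<le> S * sqrt (energy / 6)"
      using bspec[OF ctrl[unfolded pressure_controlled_def] v] nz unfolding H1 by blast
    moreover have "integral (\<Union>\<P>) (\<lambda>x. q x * divergence v x) = moment q u / 12"
      unfolding v_def by (rule integral_unique, rule bubble_divergence_integral[OF q[OF K(1)] q[OF K(2)] sub])
    ultimately show ?thesis by simp
  qed
  \<comment> \<open>The hypothesis on q is one-sided; the absolute value comes from testing with both signs.\<close>
  from this[of u] this[of "- u"] show ?thesis
    using \<open>norm u = 1\<close> by (simp add: moment_minus)
qed

end

section \<open>Cells in an orthonormal frame\<close>

lemma hull3_inner_le:
  assumes "x \<in> convex hull {A, B, C}" "l \<bullet> (A - z) \<le> k" "l \<bullet> (B - z) \<le> k" "l \<bullet> (C - z) \<le> k"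
  shows "l \<bullet> (x - z) \<le> k"
proof -
  have "{x. l \<bullet> (x - z) \<le> k} = {x. l \<bullet> x \<le> k + l \<bullet> z}" by (auto simp: inner_diff_right)
  then have "convex {x. l \<bullet> (x - z) \<le> k}" using convex_halfspace_le by simp
  then have "convex hull {A, B, C} \<subseteq> {x. l \<bullet> (x - z) \<le> k}"
    using assms(2-4) by (intro hull_minimal) auto
  then show ?thesis using assms(1) by blast
qed

definition non_overlapping :: "rectangle set \<Rightarrow> bool" where
  "non_overlapping \<C> \<longleftrightarrow> (\<forall>a b c d. (a, b, c, d) \<in> \<C> \<longrightarrow> a < b \<and> c < d) \<and>
     (\<forall>a b c d a' b' c' d'. (a, b, c, d) \<in> \<C> \<longrightarrow> (a', b', c', d') \<in> \<C> \<longrightarrow>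
        (a, b, c, d) \<noteq> (a', b', c', d') \<longrightarrow> b \<le> a' \<or> b' \<le> a \<or> d \<le> c' \<or> d' \<le> c)"

lemma non_overlapping_proper: "\<lbrakk>non_overlapping \<C>; (a, b, c, d) \<in> \<C>\<rbrakk> \<Longrightarrow> a < b \<and> c < d"
  unfolding non_overlapping_def by simp

lemma non_overlapping_disjoint:
  "\<lbrakk>non_overlapping \<C>; (a, b, c, d) \<in> \<C>; (a', b', c', d') \<in> \<C>; (a, b, c, d) \<noteq> (a', b', c', d')\<rbrakk>
    \<Longrightarrow> b \<le> a' \<or> b' \<le> a \<or> d \<le> c' \<or> d' \<le> c"
  unfolding non_overlapping_def by simp

fun transpose_cell :: "rectangle \<Rightarrow> rectangle" where
  "transpose_cell (a, b, c, d) = (c, d, a, b)"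

lemma transpose_cell_involution [simp]: "transpose_cell (transpose_cell R) = R"
  by (cases R) simp

lemma transpose_cell_image: "(a, b, c, d) \<in> transpose_cell ` \<C> \<longleftrightarrow> (c, d, a, b) \<in> \<C>"
  using inj_image_mem_iff[of transpose_cell "(c, d, a, b)" \<C>]
  by (simp add: inj_on_inverseI[of UNIV transpose_cell transpose_cell])

lemma non_overlapping_transpose:
  assumes "non_overlapping \<C>"
  shows "non_overlapping (transpose_cell ` \<C>)"
  unfolding non_overlapping_def transpose_cell_image
proof (intro conjI allI impI)
  fix a b c d a' b' c' d'
  assume R: "(c, d, a, b) \<in> \<C>"
  then show "a < b" "c < d" using non_overlapping_proper[OF assms R] by auto
  assume R': "(c', d', a', b') \<in> \<C>" and "(a, b, c, d) \<noteq> (a', b', c', d')"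
  then have "(c, d, a, b) \<noteq> (c', d', a', b')" by blast
  from non_overlapping_disjoint[OF assms R R' this]
  show "b \<le> a' \<or> b' \<le> a \<or> d \<le> c' \<or> d' \<le> c" by argo
qed

text \<open>The image of the coordinate axes under a rigid motion. Working in a frame makes the
invariance under rigid motions automatic, and exchanging g1 and g2 exchanges the roles of the two
directions.\<close>

locale coordinate_frame =
  fixes origin g1 g2 :: "real^2"
  assumes orthonormal: "g1 \<bullet> g1 = 1" "g2 \<bullet> g2 = 1" "g1 \<bullet> g2 = 0"
begin

lemma orthonormal' [simp]: "g1 \<bullet> g1 = 1" "g2 \<bullet> g2 = 1" "g1 \<bullet> g2 = 0" "g2 \<bullet> g1 = 0" "norm g1 = 1" "norm g2 = 1"
  using orthonormal by (simp_all add: inner_commute[of g2 g1] norm_eq_sqrt_inner)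

definition point :: "real \<Rightarrow> real \<Rightarrow> real^2" where
  "point s t = origin + s *\<^sub>R g1 + t *\<^sub>R g2"

definition "X x = g1 \<bullet> (x - origin)"
definition "Y x = g2 \<bullet> (x - origin)"

lemma point_diff: "point s t - point s' t' = (s - s') *\<^sub>R g1 + (t - t') *\<^sub>R g2"
  by (simp add: point_def algebra_simps)

lemma coordinate_diff:
  "g1 \<bullet> (x - point s t) = X x - s" "g2 \<bullet> (x - point s t) = Y x - t"
  by (simp_all add: point_def X_def Y_def inner_diff_right inner_add_right)

lemma coordinates_point [simp]: "X (point s t) = s" "Y (point s t) = t"
  by (simp_all add: point_def X_def Y_def inner_add_right inner_diff_right)

lemma measure_frame_triangle:
  "measure lebesgue (convex hull {point s t, point s' t', point s'' t''}) =
     \<bar>(s - s'') * (t' - t'') - (t - t'') * (s' - s'')\<bar> / 2"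
proof -
  define D where "D = g1$1 * g2$2 - g1$2 * g2$1"
  have "(g1$1)\<^sup>2 + (g1$2)\<^sup>2 = 1" "(g2$1)\<^sup>2 + (g2$2)\<^sup>2 = 1" "g1$1 * g2$1 + g1$2 * g2$2 = 0"
    using orthonormal by (simp_all add: inner_vec_def sum_2 power2_eq_square)
  then have "D\<^sup>2 = 1" unfolding D_def by algebra
  then have D: "\<bar>D\<bar> = 1" by (simp add: abs_square_eq_1)
  have "(point s t - point s'' t'')$1 * (point s' t' - point s'' t'')$2
      - (point s t - point s'' t'')$2 * (point s' t' - point s'' t'')$1 =
      ((s - s'') * (t' - t'') - (t - t'') * (s' - s'')) * D"
    unfolding point_diff D_def by (simp add: algebra_simps)
  then show ?thesis unfolding measure_triangle by (simp add: abs_mult D)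
qed

fun split_cell :: "bool \<Rightarrow> rectangle \<Rightarrow> (real^2) set set" where
  "split_cell True (a, b, c, d) =
     {convex hull {point a c, point b d, point b c}, convex hull {point a c, point b d, point a d}}"
| "split_cell False (a, b, c, d) =
     {convex hull {point b c, point a d, point a c}, convex hull {point b c, point a d, point b d}}"

definition mesh :: "rectangle set \<Rightarrow> (rectangle \<Rightarrow> bool) \<Rightarrow> (real^2) set set" where
  "mesh \<C> \<delta> = (\<Union>R\<in>\<C>. split_cell (\<delta> R) R)"

lemma split_cell_cases:
  assumes "K \<in> split_cell \<delta> (a, b, c, d)"
  shows "K = convex hull {point a c, point b d, point b c} \<or> K = convex hull {point a c, point b d, point a d} \<or>
      K = convex hull {point b c, point a d, point a c} \<or> K = convex hull {point b c, point a d, point b d}"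
  using assms by (cases \<delta>; simp; argo)

lemma split_cell_bounds:
  assumes "K \<in> split_cell \<delta> (a, b, c, d)" "x \<in> K" "a < b" "c < d"
  shows "a \<le> X x" "X x \<le> b" "c \<le> Y x" "Y x \<le> d"
proof -
  obtain A B C where K: "K = convex hull {A, B, C}"
    and V: "{A, B, C} \<subseteq> {point a c, point a d, point b c, point b d}"
    using split_cell_cases[OF assms(1)] by (elim disjE) (rule that, assumption, simp)+
  have v: "a \<le> X v \<and> X v \<le> b \<and> c \<le> Y v \<and> Y v \<le> d" if "v \<in> {A, B, C}" for v
    using subsetD[OF V that] assms(3,4) by auto
  note h = hull3_inner_le[OF assms(2)[unfolded K], of _ origin]
  show "X x \<le> b" using h[of g1 b] v by (auto simp: X_def)
  show "Y x \<le> d" using h[of g2 d] v by (auto simp: Y_def)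
  show "a \<le> X x" using h[of "- g1" "- a"] v by (auto simp: X_def)
  show "c \<le> Y x" using h[of "- g2" "- c"] v by (auto simp: Y_def)
qed

end

section \<open>The two kinds of interior edges\<close>

context coordinate_frame
begin

lemma frame_point_diff:
  "g1 \<bullet> (point s t - point s' t') = s - s'" "g2 \<bullet> (point s t - point s' t') = t - t'"
  by (simp_all add: point_diff inner_add_right)

text \<open>Letting x1 - x0 have either sign covers both diagonals of a rectangle: exchanging x0
and x1 passes from one to the other.\<close>

lemma diagonal_pair:
  assumes "x0 \<noteq> x1" "y0 \<noteq> y1"
  shows "triangle_pair (point x0 y0) (point x1 y1) (point x1 y0) (point x0 y1)
    (- ((1 / (x1 - x0)) *\<^sub>R g1)) ((1 / (y1 - y0)) *\<^sub>R g2) (- ((1 / (y1 - y0)) *\<^sub>R g2)) ((1 / (x1 - x0)) *\<^sub>R g1)"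
proof -
  have "(x0 - x1) / (x1 - x0) = -1" "(y0 - y1) / (y1 - y0) = -1"
    using assms by (simp_all add: divide_eq_minus_1_iff)
  then show ?thesis
    using assms by unfold_locales (simp_all add: dual_vectors_def frame_point_diff)
qed

text \<open>The third vertices lie on the upper or the lower side of the cells, depending on
their diagonals; e1 and e2 are 1 for the lower and 0 for the upper side.\<close>

lemma edge_pair:
  assumes "0 < w" "c < d" "e1 = 0 \<or> e1 = 1" "e2 = 0 \<or> e2 = 1"
  shows "triangle_pair (point b c) (point b d) (point (b - w) (d - e1 * (d - c))) (point (b + w) (d - e2 * (d - c)))
    ((e1 / w) *\<^sub>R g1 - (1 / (d - c)) *\<^sub>R g2) (((1 - e1) / w) *\<^sub>R g1 + (1 / (d - c)) *\<^sub>R g2)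
    (- ((e2 / w) *\<^sub>R g1) - (1 / (d - c)) *\<^sub>R g2) (- (((1 - e2) / w) *\<^sub>R g1) + (1 / (d - c)) *\<^sub>R g2)"
  unfolding triangle_pair_def dual_vectors_def inner_add_left inner_diff_left inner_minus_left inner_scaleR_left
    frame_point_diff
  using assms(3,4,1,2)
  by (elim disjE; hypsubst) (simp_all add: divide_simps)

end

locale controlled_mesh = coordinate_frame +
  fixes \<C> :: "rectangle set" and \<delta> :: "rectangle \<Rightarrow> bool" and q :: "real^2 \<Rightarrow> real" and S :: real
  assumes S_nonneg: "0 \<le> S"
    and cells: "non_overlapping \<C>"
    and affine: "K \<in> mesh \<C> \<delta> \<Longrightarrow> poly_on 1 K q"
    and controlled: "pressure_controlled (mesh \<C> \<delta>) q S"
begin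

text \<open>On the two triangles of a cell the vertical derivative of q is the difference
quotient along the right or the left side, whichever diagonal is drawn, and the bubble weighs
both equally.\<close>

lemma diagonal_bubble_estimate:
  assumes R: "(a, b, c, d) \<in> \<C>"
  shows "(b - a) * \<bar>q (point a d) - q (point a c) + (q (point b d) - q (point b c))\<bar>
    \<le> 24 * S * sqrt ((b - a) * (d - c) * (1 / (b - a)\<^sup>2 + 1 / (d - c)\<^sup>2) / 6)"
proof -
  have pos: "a < b" "c < d" using non_overlapping_proper[OF cells R] by auto
  \<comment> \<open>The diagonal joins (x0, c) and (x1, d).\<close>
  define x0 x1 where "x0 = (if \<delta> (a, b, c, d) then a else b)" and "x1 = (if \<delta> (a, b, c, d) then b else a)"
  have x: "x0 \<noteq> x1" "x0 = a \<and> x1 = b \<or> x0 = b \<and> x1 = a" using pos by (auto simp: x0_def x1_def)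
  define p r where "p = 1 / (x1 - x0)" and "r = 1 / (d - c)"
  define v1 v2 where "v1 = p *\<^sub>R g1" and "v2 = r *\<^sub>R g2"
  have r: "(d - c) * r = 1" "0 < r" using pos by (auto simp: r_def)
  have r2: "r\<^sup>2 = 1 / (d - c)\<^sup>2" by (simp add: r_def power_divide)
  have p: "p\<^sup>2 = 1 / (b - a)\<^sup>2" using x(2) by (auto simp: p_def power_divide power2_commute)
  interpret tp: triangle_pair "point x0 c" "point x1 d" "point x1 c" "point x0 d" "- v1" v2 "- v2" v1
    using diagonal_pair[of x0 x1 c d] x pos by (simp add: v1_def v2_def p_def r_def)
  have split: "split_cell (\<delta> (a, b, c, d)) (a, b, c, d) = {tp.K1, tp.K2}"
    unfolding tp.K1_def tp.K2_def unfolding x0_def x1_def by (cases "\<delta> (a, b, c, d)") simp_all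
  have K: "tp.K1 \<in> mesh \<C> \<delta>" "tp.K2 \<in> mesh \<C> \<delta>"
    using R split unfolding mesh_def by blast+
  have others: "tp.bubble x = 0" if "K \<in> mesh \<C> \<delta>" "K \<noteq> tp.K1" "K \<noteq> tp.K2" "x \<in> K" for K x
  proof (rule ccontr)
    obtain a' b' c' d' where R': "(a', b', c', d') \<in> \<C>" "K \<in> split_cell (\<delta> (a', b', c', d')) (a', b', c', d')"
      using \<open>K \<in> mesh \<C> \<delta>\<close> unfolding mesh_def by auto
    have pos': "a' < b'" "c' < d'" using non_overlapping_proper[OF cells R'(1)] by auto
    note bounds = split_cell_bounds[OF R'(2) \<open>x \<in> K\<close> pos']
    have "(a, b, c, d) \<noteq> (a', b', c', d')" using that R'(2) split by auto
    note apart = non_overlapping_disjoint[OF cells R R'(1) this]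
    assume "tp.bubble x \<noteq> 0"
    then have b: "p * (X x - x1) < 0" "0 < r * (Y x - c)" "r * (Y x - d) < 0" "0 < p * (X x - x0)"
      unfolding tp.bubble_nonzero_iff tp.s1_def tp.t1_def tp.s2_def tp.t2_def
      by (simp_all add: v1_def v2_def coordinate_diff)
    have "c < Y x" "Y x < d" using b(2,3) r(2) by (auto simp: zero_less_mult_iff mult_less_0_iff)
    moreover have "a < X x" "X x < b"
      using b(1,4) x(2) pos by (auto simp: p_def zero_less_divide_iff divide_less_0_iff)
    ultimately have "a < X x" "X x < b" "c < Y x" "Y x < d" by auto
    then show False using apart bounds by linarith
  qed
  have \<mu>: "tp.\<mu>1 = (b - a) * (d - c) / 2" "tp.\<mu>2 = (b - a) * (d - c) / 2"
    unfolding tp.\<mu>1_def tp.\<mu>2_def tp.K1_def tp.K2_def measure_frame_triangle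
    using x(2) pos by (auto simp: abs_mult)
  have e: "tp.energy = (b - a) * (d - c) * (1 / (b - a)\<^sup>2 + 1 / (d - c)\<^sup>2)"
    unfolding tp.energy_def \<mu> p[symmetric] r2[symmetric] by (simp add: v1_def v2_def power2_eq_square algebra_simps)
  define T where "T = q (point a d) - q (point a c) + (q (point b d) - q (point b c))"
  have "q (point x1 c) - q (point x0 d) + q (point x0 c) - q (point x1 d) = - T"
    using x(2) by (auto simp: T_def)
  moreover have "- v1 \<bullet> g2 = 0" "v2 \<bullet> g2 = r" "- v2 \<bullet> g2 = - r" "v1 \<bullet> g2 = 0"
    by (simp_all add: v1_def v2_def)
  ultimately have "tp.moment q g2 = - ((b - a) / 2 * T)"
    using r(1) unfolding tp.moment_def \<mu> by algebra
  then have "\<bar>tp.moment q g2\<bar> = (b - a) / 2 * \<bar>T\<bar>"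
    using pos by (simp add: abs_mult)
  moreover have "\<bar>tp.moment q g2\<bar> \<le> 12 * S * sqrt (tp.energy / 6)"
    by (rule tp.moment_bound[OF K others affine controlled]) auto
  ultimately have "(b - a) * \<bar>T\<bar> \<le> 24 * S * sqrt (tp.energy / 6)" by linarith
  then show ?thesis unfolding e T_def .
qed

text \<open>The tangential derivative of q along the common edge is the same in both adjacent
triangles.\<close>

lemma edge_bubble_estimate:
  assumes R1: "(b - w, b, c, d) \<in> \<C>" and R2: "(b, b + w, c, d) \<in> \<C>"
  shows "w * \<bar>q (point b d) - q (point b c)\<bar>
    \<le> 12 * S * sqrt (w * (d - c) * (1 / w\<^sup>2 + 1 / (d - c)\<^sup>2) / 6)"
proof -
  have pos: "0 < w" "c < d" using non_overlapping_proper[OF cells R1] by auto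
  define e1 e2 :: real where "e1 = (if \<delta> (b - w, b, c, d) then 1 else 0)"
    and "e2 = (if \<delta> (b, b + w, c, d) then 0 else 1)"
  have e: "e1 = 0 \<or> e1 = 1" "e2 = 0 \<or> e2 = 1" by (simp_all add: e1_def e2_def)
  define p r where "p = 1 / w" and "r = 1 / (d - c)"
  have pr: "p * w = 1" "r * (d - c) = 1" "0 < p" "0 < r" using pos by (auto simp: p_def r_def)
  define y1 y2 where "y1 = d - e1 * (d - c)" and "y2 = d - e2 * (d - c)"
  define l1 m1 l2 m2 where "l1 = (e1 * p) *\<^sub>R g1 - r *\<^sub>R g2" and "m1 = ((1 - e1) * p) *\<^sub>R g1 + r *\<^sub>R g2"
    and "l2 = - ((e2 * p) *\<^sub>R g1) - r *\<^sub>R g2" and "m2 = - (((1 - e2) * p) *\<^sub>R g1) + r *\<^sub>R g2"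
  interpret tp: triangle_pair "point b c" "point b d" "point (b - w) y1" "point (b + w) y2" l1 m1 l2 m2
    using edge_pair[OF pos e, of b] by (simp add: l1_def m1_def l2_def m2_def y1_def y2_def p_def r_def)
  \<comment> \<open>The triangles of the two cells that do not contain the common edge: on each of them one of
    the affine pieces of the hat functions is nonpositive.\<close>
  define K1' where "K1' = (if \<delta> (b - w, b, c, d) then convex hull {point (b - w) c, point b d, point (b - w) d}
    else convex hull {point b c, point (b - w) d, point (b - w) c})"
  define K2' where "K2' = (if \<delta> (b, b + w, c, d) then convex hull {point b c, point (b + w) d, point (b + w) c}
    else convex hull {point (b + w) c, point b d, point (b + w) d})"
  have split1: "split_cell (\<delta> (b - w, b, c, d)) (b - w, b, c, d) = {tp.K1, K1'}"
    unfolding tp.K1_def K1'_def unfolding y1_def e1_def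
    by (cases "\<delta> (b - w, b, c, d)") (simp_all add: insert_commute)
  have split2: "split_cell (\<delta> (b, b + w, c, d)) (b, b + w, c, d) = {tp.K2, K2'}"
    unfolding tp.K2_def K2'_def unfolding y2_def e2_def
    by (cases "\<delta> (b, b + w, c, d)") (simp_all add: insert_commute)
  have K: "tp.K1 \<in> mesh \<C> \<delta>" "tp.K2 \<in> mesh \<C> \<delta>"
    using R1 R2 split1 split2 unfolding mesh_def by blast+
  \<comment> \<open>In these coordinates the edge is 0 \<times> [0,1] and the two cells are [-1,0] \<times> [0,1] and [0,1] \<times> [0,1].\<close>
  define \<xi> \<eta> where "\<xi> x = p * (X x - b)" and "\<eta> x = r * (Y x - c)" for x
  have coords: "tp.s1 x = 1 + e1 * \<xi> x - \<eta> x" "tp.t1 x = (1 - e1) * \<xi> x + \<eta> x"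
    "tp.s2 x = 1 - e2 * \<xi> x - \<eta> x" "tp.t2 x = \<eta> x - (1 - e2) * \<xi> x" for x
  proof -
    have "g1 \<bullet> (x - point (b - w) y1) = X x - b + w" "g1 \<bullet> (x - point (b + w) y2) = X x - b - w"
      "g2 \<bullet> (x - point (b - w) y1) = Y x - c - (1 - e1) * (d - c)"
      "g2 \<bullet> (x - point (b + w) y2) = Y x - c - (1 - e2) * (d - c)"
      unfolding coordinate_diff y1_def y2_def by (simp_all add: algebra_simps)
    note g = this
    show "tp.s1 x = 1 + e1 * \<xi> x - \<eta> x"
      unfolding tp.s1_def unfolding l1_def inner_diff_left inner_scaleR_left g \<xi>_def \<eta>_def using pr(1,2) by algebra
    show "tp.t1 x = (1 - e1) * \<xi> x + \<eta> x"
      unfolding tp.t1_def unfolding m1_def inner_add_left inner_scaleR_left g \<xi>_def \<eta>_def using pr(1,2) by algebra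
    show "tp.s2 x = 1 - e2 * \<xi> x - \<eta> x"
      unfolding tp.s2_def unfolding l2_def inner_diff_left inner_minus_left inner_scaleR_left g \<xi>_def \<eta>_def using pr(1,2) by algebra
    show "tp.t2 x = \<eta> x - (1 - e2) * \<xi> x"
      unfolding tp.t2_def unfolding m2_def inner_add_left inner_minus_left inner_scaleR_left g \<xi>_def \<eta>_def using pr(1,2) by algebra
  qed
  have at: "\<xi> (point (b - w) t) = - 1" "\<xi> (point b t) = 0" "\<xi> (point (b + w) t) = 1"
    "\<eta> (point t c) = 0" "\<eta> (point t d) = 1" for t
    using pr by (simp_all add: \<xi>_def \<eta>_def)
  have vanish1: "tp.bubble x = 0" if x: "x \<in> K1'" for x
  proof (cases "\<delta> (b - w, b, c, d)")
    case True
    then have e1: "e1 = 1" by (simp add: e1_def)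
    have "tp.s1 x \<le> 0"
      unfolding tp.s1_def
      by (rule hull3_inner_le[OF x[unfolded K1'_def if_P[OF True]]]; fold tp.s1_def; unfold coords at e1; simp)
    then show ?thesis using tp.bubble_nonzero_iff[of x] by linarith
  next
    case False
    then have e1: "e1 = 0" by (simp add: e1_def)
    have "tp.t1 x \<le> 0"
      unfolding tp.t1_def
      by (rule hull3_inner_le[OF x[unfolded K1'_def if_not_P[OF False]]]; fold tp.t1_def; unfold coords at e1; simp)
    then show ?thesis using tp.bubble_nonzero_iff[of x] by linarith
  qed
  have vanish2: "tp.bubble x = 0" if x: "x \<in> K2'" for x
  proof (cases "\<delta> (b, b + w, c, d)")
    case True
    then have e2: "e2 = 0" by (simp add: e2_def)
    have "tp.t2 x \<le> 0"
      unfolding tp.t2_def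
      by (rule hull3_inner_le[OF x[unfolded K2'_def if_P[OF True]]]; fold tp.t2_def; unfold coords at e2; simp)
    then show ?thesis using tp.bubble_nonzero_iff[of x] by linarith
  next
    case False
    then have e2: "e2 = 1" by (simp add: e2_def)
    have "tp.s2 x \<le> 0"
      unfolding tp.s2_def
      by (rule hull3_inner_le[OF x[unfolded K2'_def if_not_P[OF False]]]; fold tp.s2_def; unfold coords at e2; simp)
    then show ?thesis using tp.bubble_nonzero_iff[of x] by linarith
  qed
  have support: "b - w < X x \<and> X x < b + w \<and> c < Y x \<and> Y x < d" if nz: "tp.bubble x \<noteq> 0" for x
  proof -
    have pos4: "0 < 1 + e1 * \<xi> x - \<eta> x" "0 < (1 - e1) * \<xi> x + \<eta> x"
      "0 < 1 - e2 * \<xi> x - \<eta> x" "0 < \<eta> x - (1 - e2) * \<xi> x"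
      using nz unfolding tp.bubble_nonzero_iff coords by auto
    then have "- 1 < \<xi> x" "\<xi> x < 1" "0 < \<eta> x" "\<eta> x < 1" using e by auto
    moreover have "\<xi> x = (X x - b) / w" "\<eta> x = (Y x - c) / (d - c)"
      by (simp_all add: \<xi>_def \<eta>_def p_def r_def)
    ultimately show ?thesis using pos by (simp add: field_simps)
  qed
  have others: "tp.bubble x = 0" if "K \<in> mesh \<C> \<delta>" "K \<noteq> tp.K1" "K \<noteq> tp.K2" "x \<in> K" for K x
  proof (rule ccontr)
    obtain a' b' c' d' where R': "(a', b', c', d') \<in> \<C>" "K \<in> split_cell (\<delta> (a', b', c', d')) (a', b', c', d')"
      using \<open>K \<in> mesh \<C> \<delta>\<close> unfolding mesh_def by auto
    have pos': "a' < b'" "c' < d'" using non_overlapping_proper[OF cells R'(1)] by auto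
    note bounds = split_cell_bounds[OF R'(2) \<open>x \<in> K\<close> pos']
    assume nz: "tp.bubble x \<noteq> 0"
    then have "K \<noteq> K1'" "K \<noteq> K2'" using vanish1 vanish2 \<open>x \<in> K\<close> by auto
    then have "K \<notin> {tp.K1, K1'}" "K \<notin> {tp.K2, K2'}" using that(2,3) by blast+
    then have n: "(b - w, b, c, d) \<noteq> (a', b', c', d')" "(b, b + w, c, d) \<noteq> (a', b', c', d')"
      using R'(2) unfolding split1[symmetric] split2[symmetric] by metis+
    note apart = non_overlapping_disjoint[OF cells R1 R'(1) n(1)] non_overlapping_disjoint[OF cells R2 R'(1) n(2)]
    show False using apart bounds support[OF nz] pos' by linarith
  qed
  have "(b - (b - w)) * (d - y1) - (c - y1) * (b - (b - w)) = w * (d - c)"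
    "(b - (b + w)) * (d - y2) - (c - y2) * (b - (b + w)) = - (w * (d - c))"
    by (simp_all add: algebra_simps)
  then have \<mu>: "tp.\<mu>1 = w * (d - c) / 2" "tp.\<mu>2 = w * (d - c) / 2"
    unfolding tp.\<mu>1_def tp.\<mu>2_def tp.K1_def tp.K2_def measure_frame_triangle
    using pos by simp_all
  have p2: "p\<^sup>2 = 1 / w\<^sup>2" "r\<^sup>2 = 1 / (d - c)\<^sup>2" by (simp_all add: p_def r_def power_divide)
  have "l1 \<bullet> l1 + l1 \<bullet> m1 + m1 \<bullet> m1 = p\<^sup>2 + r\<^sup>2" "l2 \<bullet> l2 + l2 \<bullet> m2 + m2 \<bullet> m2 = p\<^sup>2 + r\<^sup>2"
    using e by (auto simp: l1_def m1_def l2_def m2_def inner_add_left inner_diff_left inner_add_right inner_diff_right power2_eq_square)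
  then have en: "tp.energy = w * (d - c) * (1 / w\<^sup>2 + 1 / (d - c)\<^sup>2)"
    unfolding tp.energy_def \<mu> p2[symmetric] by simp
  have "l1 \<bullet> g2 = - r" "m1 \<bullet> g2 = r" "l2 \<bullet> g2 = - r" "m2 \<bullet> g2 = r"
    by (simp_all add: l1_def m1_def l2_def m2_def inner_add_left inner_diff_left)
  then have "tp.moment q g2 = - (w * (q (point b d) - q (point b c)))"
    using pr(2) unfolding tp.moment_def \<mu> by algebra
  then have "\<bar>tp.moment q g2\<bar> = w * \<bar>q (point b d) - q (point b c)\<bar>"
    using pos by (simp add: abs_mult)
  moreover have "\<bar>tp.moment q g2\<bar> \<le> 12 * S * sqrt (tp.energy / 6)"
    by (rule tp.moment_bound[OF K others affine controlled]) auto
  ultimately show ?thesis by (simp add: en)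
qed

end

section \<open>Control of vertex differences\<close>

text \<open>This is where the aspect ratio drops out: for a cell with h \<open>\<le>\<close>
\<open>\<kappa>\<close> w the energy of the bubble is at most of the order of
\<open>\<kappa>\<^sup>2\<close> w/h, and dividing its square root by w leaves a multiple of the
reciprocal of sqrt (w h).\<close>

lemma scale_estimate:
  fixes w h t :: real
  assumes "0 < w" "0 < h" "1 \<le> \<kappa>" "h \<le> \<kappa> * w" "0 \<le> k" "0 \<le> S"
    and est: "w * \<bar>t\<bar> \<le> k * S * sqrt (w * h * (1 / w\<^sup>2 + 1 / h\<^sup>2) / 6)"
  shows "\<bar>t\<bar> * sqrt (w * h) \<le> k * \<kappa> * S"
proof -
  define z where "z = (\<kappa> * w)\<^sup>2"
  have "h\<^sup>2 \<le> z" unfolding z_def using assms(2,4) by (intro power_mono) auto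
  moreover have "w\<^sup>2 \<le> z" unfolding z_def using assms(1,3) by (intro power_mono) auto
  ultimately have "h\<^sup>2 + w\<^sup>2 \<le> z + z" by (rule add_mono)
  moreover have "z + z \<le> 6 * z" by (simp add: z_def)
  ultimately have "(h\<^sup>2 + w\<^sup>2) / 6 \<le> z" by simp
  then have "sqrt ((h\<^sup>2 + w\<^sup>2) / 6) \<le> \<kappa> * w"
    using assms(1,3) unfolding z_def by (intro real_le_lsqrt) auto
  moreover have "sqrt (w * h * (1 / w\<^sup>2 + 1 / h\<^sup>2) / 6) * sqrt (w * h) = sqrt ((h\<^sup>2 + w\<^sup>2) / 6)"
  proof -
    have "w * h * (1 / w\<^sup>2 + 1 / h\<^sup>2) / 6 * (w * h) = (h\<^sup>2 + w\<^sup>2) / 6"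
      using assms(1,2) by (simp add: field_simps power2_eq_square)
    then show ?thesis by (simp flip: real_sqrt_mult)
  qed
  moreover have "0 \<le> k * S" using assms by simp
  ultimately have "k * S * (sqrt (w * h * (1 / w\<^sup>2 + 1 / h\<^sup>2) / 6) * sqrt (w * h)) \<le> k * S * (\<kappa> * w)"
    by (intro mult_left_mono) simp_all
  moreover have "w * \<bar>t\<bar> * sqrt (w * h) \<le> k * S * sqrt (w * h * (1 / w\<^sup>2 + 1 / h\<^sup>2) / 6) * sqrt (w * h)"
    using assms(1,2) by (intro mult_right_mono est) auto
  ultimately have "w * (\<bar>t\<bar> * sqrt (w * h)) \<le> w * (k * \<kappa> * S)" by (simp add: mult_ac)
  then show ?thesis using assms(1) by simp
qed

context coordinate_frame
begin

lemma transposed_frame: "coordinate_frame g2 g1"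
  by unfold_locales simp_all

lemma transposed_point: "coordinate_frame.point origin g2 g1 s t = point t s"
  by (simp add: coordinate_frame.point_def[OF transposed_frame] point_def add_ac)

text \<open>A diagonal from lower left to upper right remains one when the coordinates are
exchanged, so the choice of the diagonal is kept.\<close>

lemma transposed_split_cell:
  "coordinate_frame.split_cell origin g2 g1 \<delta> (transpose_cell R) = split_cell \<delta> R"
proof -
  interpret tr: coordinate_frame origin g2 g1 by (rule transposed_frame)
  obtain a b c d where R: "R = (a, b, c, d)" by (cases R) auto
  show ?thesis
    by (cases \<delta>) (simp_all add: R transposed_point insert_commute)
qed

lemma transposed_mesh:
  "coordinate_frame.mesh origin g2 g1 (transpose_cell ` \<C>) (\<delta> \<circ> transpose_cell) = mesh \<C> \<delta>"
  unfolding coordinate_frame.mesh_def[OF transposed_frame] mesh_def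
  by (simp add: transposed_split_cell)

end

context controlled_mesh
begin

lemma transposed_controlled: "controlled_mesh origin g2 g1 (transpose_cell ` \<C>) (\<delta> \<circ> transpose_cell) q S"
proof -
  interpret tr: coordinate_frame origin g2 g1 by (rule transposed_frame)
  show ?thesis
    by unfold_locales
      (simp_all add: S_nonneg non_overlapping_transpose[OF cells] transposed_mesh controlled affine del: One_nat_def)
qed

lemma diagonal_estimate:
  assumes R: "(a, b, c, d) \<in> \<C>" and \<kappa>: "1 \<le> \<kappa>" "d - c \<le> \<kappa> * (b - a)"
  shows "\<bar>q (point a d) - q (point a c) + (q (point b d) - q (point b c))\<bar> * sqrt ((b - a) * (d - c)) \<le> 24 * \<kappa> * S"
  using non_overlapping_proper[OF cells R] S_nonneg \<kappa>
  by (intro scale_estimate diagonal_bubble_estimate[OF R]) auto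

lemma edge_estimate:
  assumes R: "(a, b, c, d) \<in> \<C>" "(b, e, c, d) \<in> \<C>" "e - b = b - a"
    and \<kappa>: "1 \<le> \<kappa>" "d - c \<le> \<kappa> * (b - a)"
  shows "\<bar>q (point b d) - q (point b c)\<bar> * sqrt ((b - a) * (d - c)) \<le> 12 * \<kappa> * S"
proof -
  have a: "a = b - (b - a)" and e: "e = b + (b - a)" using R(3) by simp_all
  have "(b - a) * \<bar>q (point b d) - q (point b c)\<bar>
    \<le> 12 * S * sqrt ((b - a) * (d - c) * (1 / (b - a)\<^sup>2 + 1 / (d - c)\<^sup>2) / 6)"
    using edge_bubble_estimate[of b "b - a" c d] R(1,2) by (simp add: e)
  then show ?thesis
    using non_overlapping_proper[OF cells R(1)] S_nonneg \<kappa> by (intro scale_estimate) auto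
qed

text \<open>The middle line is controlled by the edge bubble, the outer ones by the diagonal
bubbles, which see the sum with the middle line.\<close>

lemma vertical_differences:
  assumes R: "(a, b, c, d) \<in> \<C>" "(b, e, c, d) \<in> \<C>" "e - b = b - a"
    and \<kappa>: "1 \<le> \<kappa>" "d - c \<le> \<kappa> * (b - a)" and s: "s \<in> {a, b, e}"
  shows "\<bar>q (point s d) - q (point s c)\<bar> * sqrt ((b - a) * (d - c)) \<le> 36 * \<kappa> * S"
proof -
  define N D where "N = sqrt ((b - a) * (d - c))" and "D s = q (point s d) - q (point s c)" for s
  have "0 \<le> N" using non_overlapping_proper[OF cells R(1)] by (simp add: N_def)
  then have N: "\<bar>x\<bar> * N = \<bar>x * N\<bar>" for x by (simp add: abs_mult)
  have "\<bar>(D a + D b) * N\<bar> \<le> 24 * \<kappa> * S" "\<bar>(D b + D e) * N\<bar> \<le> 24 * \<kappa> * S" "\<bar>D b * N\<bar> \<le> 12 * \<kappa> * S"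
    using diagonal_estimate[OF R(1) \<kappa>] diagonal_estimate[OF R(2) \<kappa>(1)] edge_estimate[OF R \<kappa>] R(3) \<kappa>(2)
    by (simp_all add: D_def N[symmetric], simp_all add: N_def)
  then have "\<bar>D s * N\<bar> \<le> 36 * \<kappa> * S"
    using s unfolding distrib_right by auto
  then show ?thesis unfolding N[symmetric] by (simp add: D_def N_def)
qed

text \<open>In each cell the sum of the two horizontal differences is controlled by the diagonal
bubble in the other direction, and their difference equals the difference of two vertical ones.
No horizontal edge is used, so that a single row of two cells suffices.\<close>

lemma regular_pair:
  assumes R: "(a, b, c, d) \<in> \<C>" "(b, e, c, d) \<in> \<C>" "e - b = b - a"
    and \<kappa>: "1 \<le> \<kappa>" "d - c \<le> \<kappa> * (b - a)" "b - a \<le> \<kappa> * (d - c)"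
    and s: "s \<in> {a, b, e}" and t: "t \<in> {c, d}"
  shows "\<bar>q (point s t) - q (point b c)\<bar> * sqrt ((b - a) * (d - c)) \<le> 84 * \<kappa> * S"
proof -
  interpret tr: controlled_mesh origin g2 g1 "transpose_cell ` \<C>" "\<delta> \<circ> transpose_cell" q S
    by (rule transposed_controlled)
  define N v where "N = sqrt ((b - a) * (d - c))" and "v s t = q (point s t) * N" for s t
  have N': "sqrt ((d - c) * (b - a)) = N" "sqrt ((d - c) * (e - b)) = N" using R(3) by (simp_all add: N_def mult.commute)
  have "0 \<le> N" using non_overlapping_proper[OF cells R(1)] by (simp add: N_def)
  then have N: "\<bar>x\<bar> * N = \<bar>x * N\<bar>" for x by (simp add: abs_mult)
  have "\<bar>v s d - v s c\<bar> \<le> 36 * \<kappa> * S" if "s \<in> {a, b, e}" for s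
    using vertical_differences[OF R \<kappa>(1,2) that] unfolding N_def[symmetric] N by (simp add: v_def left_diff_distrib)
  then have vert: "\<bar>v a d - v a c\<bar> \<le> 36 * \<kappa> * S" "\<bar>v e d - v e c\<bar> \<le> 36 * \<kappa> * S"
    by simp_all
  have mid: "\<bar>v b d - v b c\<bar> \<le> 12 * \<kappa> * S"
    using edge_estimate[OF R \<kappa>(1,2)] unfolding N_def[symmetric] N by (simp add: v_def left_diff_distrib)
  have T: "(c, d, a, b) \<in> transpose_cell ` \<C>" "(c, d, b, e) \<in> transpose_cell ` \<C>"
    using R(1,2) by (simp_all add: transpose_cell_image)
  have "\<bar>v b c - v a c + (v b d - v a d)\<bar> \<le> 24 * \<kappa> * S"
    using tr.diagonal_estimate[OF T(1) \<kappa>(1,3)] unfolding transposed_point N' N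
    by (simp add: v_def left_diff_distrib distrib_right)
  moreover have "\<bar>v e c - v b c + (v e d - v b d)\<bar> \<le> 24 * \<kappa> * S"
    using tr.diagonal_estimate[OF T(2) \<kappa>(1)] \<kappa>(3) R(3) unfolding transposed_point N' N
    by (simp add: v_def left_diff_distrib distrib_right)
  moreover have "0 \<le> \<kappa> * S" using \<kappa>(1) S_nonneg by simp
  ultimately have "\<bar>v s t - v b c\<bar> \<le> 84 * (\<kappa> * S)"
    using vert mid s t by (auto simp: mult.assoc abs_le_iff)
  then show ?thesis
    unfolding N_def[symmetric] N by (simp add: v_def left_diff_distrib)
qed

text \<open>The values on the upper side are known in the scaling of a neighbouring cell of
height r above; descending costs one vertical difference.\<close>

lemma flat_pair:
  assumes R: "(a, b, c, d) \<in> \<C>" "(b, e, c, d) \<in> \<C>" "e - b = b - a"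
    and \<kappa>: "1 \<le> \<kappa>" "d - c \<le> \<kappa> * (b - a)"
    and top: "\<And>s. s \<in> {a, b, e} \<Longrightarrow> \<bar>q (point s d) - q0\<bar> * sqrt ((b - a) * r) \<le> B"
    and r: "0 \<le> \<rho>" "d - c \<le> \<rho>\<^sup>2 * r"
    and s: "s \<in> {a, b, e}" and t: "t \<in> {c, d}"
  shows "\<bar>q (point s t) - q0\<bar> * sqrt ((b - a) * (d - c)) \<le> 36 * \<kappa> * S + \<rho> * B"
proof -
  define N where "N = sqrt ((b - a) * (d - c))"
  have pos: "0 < b - a" "0 < d - c" using non_overlapping_proper[OF cells R(1)] by auto
  then have "0 \<le> N" by (simp add: N_def)
  have "(b - a) * (d - c) \<le> (b - a) * (\<rho>\<^sup>2 * r)" using r(2) pos by (intro mult_left_mono) auto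
  then have "N \<le> sqrt (\<rho>\<^sup>2 * ((b - a) * r))" by (simp add: N_def mult.left_commute)
  also have "\<dots> = \<rho> * sqrt ((b - a) * r)" using r(1) by (simp add: real_sqrt_mult)
  finally have "\<bar>q (point s d) - q0\<bar> * N \<le> \<bar>q (point s d) - q0\<bar> * (\<rho> * sqrt ((b - a) * r))"
    by (rule mult_left_mono) simp
  also have "\<dots> = \<rho> * (\<bar>q (point s d) - q0\<bar> * sqrt ((b - a) * r))" by simp
  also have "\<dots> \<le> \<rho> * B" using top[OF s] r(1) by (intro mult_left_mono)
  finally have 1: "\<bar>q (point s d) - q0\<bar> * N \<le> \<rho> * B" .
  have 2: "\<bar>q (point s d) - q (point s c)\<bar> * N \<le> 36 * \<kappa> * S"
    using vertical_differences[OF R \<kappa> s] by (simp add: N_def)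
  have 3: "0 \<le> 36 * \<kappa> * S" using \<kappa>(1) S_nonneg by simp
  have "\<bar>q (point s c) - q0\<bar> \<le> \<bar>q (point s d) - q (point s c)\<bar> + \<bar>q (point s d) - q0\<bar>" by linarith
  then have "\<bar>q (point s c) - q0\<bar> * N \<le> (\<bar>q (point s d) - q (point s c)\<bar> + \<bar>q (point s d) - q0\<bar>) * N"
    using \<open>0 \<le> N\<close> by (intro mult_right_mono)
  then have "\<bar>q (point s c) - q0\<bar> * N \<le> 36 * \<kappa> * S + \<rho> * B"
    using 1 2 by (simp add: distrib_right)
  then show ?thesis
    using t 1 3 unfolding N_def[symmetric] by (elim insertE emptyE; hypsubst) linarith+
qed

end

section \<open>From vertex values to the norm\<close>

lemma integral_Union_le:
  fixes f :: "'a::euclidean_space \<Rightarrow> real"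
  assumes "finite \<P>" "\<And>K. K \<in> \<P> \<Longrightarrow> compact K" "continuous_on (\<Union>\<P>) f" "\<And>x. 0 \<le> f x"
  shows "integral (\<Union>\<P>) f \<le> (\<Sum>K\<in>\<P>. integral K f)"
  using assms(1-3)
proof (induction \<P>)
  case empty
  then show ?case by simp
next
  case (insert K \<P>)
  have int: "f integrable_on T" if "compact T" "T \<subseteq> \<Union>(insert K \<P>)" for T
    using continuous_on_compact_integrable[OF that(1) continuous_on_subset[OF insert.prems(2) that(2)]] .
  have cP: "compact (\<Union>\<P>)" using insert.hyps(1) insert.prems(1) by (intro compact_Union) auto
  have cK: "compact K" using insert.prems(1) by simp
  define F where "F T x = (if x \<in> T then f x else 0)" for T x
  have F: "(F T has_integral integral T f) UNIV" if "compact T" "T \<subseteq> \<Union>(insert K \<P>)" for T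
    unfolding F_def[abs_def] has_integral_restrict_UNIV using int[OF that] by (rule integrable_integral)
  have "integral (K \<union> \<Union>\<P>) f \<le> integral K f + integral (\<Union>\<P>) f"
    by (rule has_integral_le[OF F has_integral_add[OF F F]])
      (use assms(4) cK cP in \<open>auto simp: F_def intro!: compact_Un\<close>)
  also have "integral (\<Union>\<P>) f \<le> (\<Sum>K\<in>\<P>. integral K f)"
    using insert.prems by (intro insert.IH) (auto intro: continuous_on_subset)
  finally show ?case using insert.hyps by simp
qed

lemma (in coordinate_frame) compact_mesh:
  assumes "finite \<C>"
  shows "compact (\<Union>(mesh \<C> \<delta>))" and "K \<in> mesh \<C> \<delta> \<Longrightarrow> compact K" and "finite (mesh \<C> \<delta>)"
    and "card (mesh \<C> \<delta>) \<le> 2 * card \<C>"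
proof -
  have split: "finite (split_cell \<beta> R) \<and> card (split_cell \<beta> R) \<le> 2 \<and> (\<forall>K\<in>split_cell \<beta> R. compact K)" for \<beta> R
  proof -
    obtain a b c d where "R = (a, b, c, d)" by (cases R) auto
    then show ?thesis by (cases \<beta>) (auto intro: order_trans[OF card_insert_le_m1] simp: compact_triangle)
  qed
  show fin: "finite (mesh \<C> \<delta>)" unfolding mesh_def using assms split by blast
  show comp: "compact K" if "K \<in> mesh \<C> \<delta>" for K using that split unfolding mesh_def by blast
  show "compact (\<Union>(mesh \<C> \<delta>))" using fin comp by (intro compact_Union) auto
  have "card (mesh \<C> \<delta>) \<le> (\<Sum>R\<in>\<C>. card (split_cell (\<delta> R) R))"
    unfolding mesh_def by (rule card_UN_le[OF assms])
  also have "\<dots> \<le> (\<Sum>R\<in>\<C>. 2)" by (intro sum_mono) (use split in blast)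
  finally show "card (mesh \<C> \<delta>) \<le> 2 * card \<C>" by simp
qed

lemma hull3_abs_le:
  assumes "poly_on 1 (convex hull {A, B, C}) q" "x \<in> convex hull {A, B, C}"
    and "\<bar>q A - q0\<bar> \<le> k" "\<bar>q B - q0\<bar> \<le> k" "\<bar>q C - q0\<bar> \<le> k"
  shows "\<bar>q x - q0\<bar> \<le> k"
proof -
  obtain k0 k1 k2 where q: "\<And>x. x \<in> convex hull {A, B, C} \<Longrightarrow> q x = k0 + k1 * x$1 + k2 * x$2"
    using assms(1) unfolding poly_on_1_iff by blast
  have in_hull: "A \<in> convex hull {A, B, C}" "B \<in> convex hull {A, B, C}" "C \<in> convex hull {A, B, C}"
    by (simp_all add: hull_inc)
  define l :: "real^2" where "l = vector [k1, k2]"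
  have l: "l \<bullet> (y - 0) = k1 * y$1 + k2 * y$2" for y by (simp add: l_def inner_vec_def sum_2)
  have "l \<bullet> (x - 0) \<le> q0 + k - k0" "(- l) \<bullet> (x - 0) \<le> k0 - q0 + k"
    by (rule hull3_inner_le[OF assms(2)];
        use q[OF in_hull(1)] q[OF in_hull(2)] q[OF in_hull(3)] assms(3-5) in \<open>simp only: inner_minus_left l; linarith\<close>)+
  then show ?thesis
    using q[OF assms(2)] unfolding inner_minus_left l by linarith
qed

text \<open>Among the constants, the mean value is the best approximation.\<close>

lemma integral_square_shift:
  fixes q :: "real^2 \<Rightarrow> real"
  assumes "compact \<omega>" "continuous_on \<omega> q" "integral \<omega> q = 0"
  shows "integral \<omega> (\<lambda>x. (q x)\<^sup>2) \<le> integral \<omega> (\<lambda>x. (q x - q0)\<^sup>2)"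
proof -
  have int: "f integrable_on \<omega>" if "continuous_on \<omega> f" for f :: "real^2 \<Rightarrow> real"
    by (rule continuous_on_compact_integrable[OF assms(1) that])
  have "((\<lambda>x. (q x)\<^sup>2) has_integral integral \<omega> (\<lambda>x. (q x)\<^sup>2)) \<omega>"
    by (intro integrable_integral int continuous_intros assms)
  moreover have "(q has_integral 0) \<omega>"
    using integrable_integral[OF int[OF assms(2)]] assms(3) by simp
  moreover have "((\<lambda>x. q0\<^sup>2) has_integral integral \<omega> (\<lambda>x. q0\<^sup>2)) \<omega>"
    by (intro integrable_integral int continuous_intros)
  ultimately have "((\<lambda>x. (q x)\<^sup>2 + (-2 * q0) * q x + q0\<^sup>2) has_integral
      integral \<omega> (\<lambda>x. (q x)\<^sup>2) + (-2 * q0) * 0 + integral \<omega> (\<lambda>x. q0\<^sup>2)) \<omega>"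
    by (intro has_integral_add has_integral_mult_right)
  moreover have "(\<lambda>x. (q x)\<^sup>2 + (-2 * q0) * q x + q0\<^sup>2) = (\<lambda>x. (q x - q0)\<^sup>2)"
    by (auto simp: power2_eq_square algebra_simps)
  moreover have "0 \<le> integral \<omega> (\<lambda>x. q0\<^sup>2)"
    by (intro integral_nonneg int continuous_intros) auto
  ultimately show ?thesis by (simp add: integral_unique)
qed

context controlled_mesh
begin

definition cell_near :: "real \<Rightarrow> real \<Rightarrow> rectangle \<Rightarrow> bool" where
  "cell_near q0 B = (\<lambda>(a, b, c, d). \<forall>s\<in>{a, b}. \<forall>t\<in>{c, d}.
     \<bar>q (point s t) - q0\<bar> * sqrt ((b - a) * (d - c)) \<le> B)"

lemma triangle_square_bound:
  assumes K: "K \<in> split_cell (\<delta> (a, b, c, d)) (a, b, c, d)" and R: "(a, b, c, d) \<in> \<C>"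
    and near: "cell_near q0 B (a, b, c, d)"
  shows "integral K (\<lambda>x. (q x - q0)\<^sup>2) \<le> B\<^sup>2"
proof -
  have pos: "a < b" "c < d" using non_overlapping_proper[OF cells R] by auto
  define N where "N = (b - a) * (d - c)"
  have N: "0 < N" "0 < sqrt N" using pos by (simp_all add: N_def)
  have vertex: "\<bar>q (point s t) - q0\<bar> \<le> B / sqrt N" if "s \<in> {a, b}" "t \<in> {c, d}" for s t
    using near that N(2) unfolding cell_near_def case_prod_conv N_def[symmetric] pos_le_divide_eq[OF N(2)] by blast
  have qK: "poly_on 1 K q" using affine K R unfolding mesh_def by blast
  have "\<exists>A B' C. K = convex hull {A, B', C} \<and> \<bar>q A - q0\<bar> \<le> B / sqrt N \<and> \<bar>q B' - q0\<bar> \<le> B / sqrt N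
     \<and> \<bar>q C - q0\<bar> \<le> B / sqrt N \<and> measure lebesgue K = N / 2"
  proof -
    have area: "\<bar>(a - b) * (d - c)\<bar> = N" "\<bar>(b - a) * (d - c)\<bar> = N" "\<bar>(a - b) * (c - d)\<bar> = N" "\<bar>(b - a) * (c - d)\<bar> = N"
      "\<bar>(d - c) * (b - a)\<bar> = N" "\<bar>(c - d) * (b - a)\<bar> = N" "\<bar>(d - c) * (a - b)\<bar> = N" "\<bar>(c - d) * (a - b)\<bar> = N"
      using pos by (auto simp: N_def abs_mult)
    have v: "\<bar>q (point a c) - q0\<bar> \<le> B / sqrt N" "\<bar>q (point a d) - q0\<bar> \<le> B / sqrt N"
      "\<bar>q (point b c) - q0\<bar> \<le> B / sqrt N" "\<bar>q (point b d) - q0\<bar> \<le> B / sqrt N"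
      using vertex by blast+
    show ?thesis
      using split_cell_cases[OF K]
      by (elim disjE) (intro exI conjI, assumption, rule v, rule v, rule v, simp add: measure_frame_triangle area)+
  qed
  then obtain A B' C where K3: "K = convex hull {A, B', C}" and v: "\<bar>q A - q0\<bar> \<le> B / sqrt N"
    "\<bar>q B' - q0\<bar> \<le> B / sqrt N" "\<bar>q C - q0\<bar> \<le> B / sqrt N" and m: "measure lebesgue K = N / 2" by blast
  have cK: "compact K" unfolding K3 by (rule compact_triangle)
  have cq: "continuous_on K q"
  proof -
    obtain k0 k1 k2 where "\<forall>x\<in>K. q x = k0 + k1 * x$1 + k2 * x$2" using qK unfolding poly_on_1_iff by blast
    moreover have "continuous_on K (\<lambda>x. k0 + k1 * x$1 + k2 * x$2)" by (intro continuous_intros)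
    ultimately show ?thesis by (metis (no_types, lifting) continuous_on_cong)
  qed
  have "integral K (\<lambda>x. (q x - q0)\<^sup>2) \<le> integral K (\<lambda>x. B\<^sup>2 / N)"
  proof (rule integral_le)
    show "(\<lambda>x. (q x - q0)\<^sup>2) integrable_on K" "(\<lambda>x. B\<^sup>2 / N) integrable_on K"
      by (intro continuous_on_compact_integrable cK continuous_intros cq)+
    fix x assume "x \<in> K"
    have "\<bar>q x - q0\<bar> \<le> B / sqrt N"
      by (rule hull3_abs_le[OF _ _ v]) (use qK \<open>x \<in> K\<close> K3 in auto)
    then have "\<bar>q x - q0\<bar>\<^sup>2 \<le> (B / sqrt N)\<^sup>2" by (rule power_mono) simp
    then show "(q x - q0)\<^sup>2 \<le> B\<^sup>2 / N" using N(1) by (simp add: power_divide)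
  qed
  also have "\<dots> = (B\<^sup>2 / N) * measure lebesgue K"
    using lmeasure_integral[OF lmeasurable_compact[OF cK]] integral_mult_right[of K "B\<^sup>2 / N" "\<lambda>x. 1"] by simp
  also have "\<dots> = B\<^sup>2 / 2" unfolding m using N(1) by simp
  also have "\<dots> \<le> B\<^sup>2" by simp
  finally show ?thesis .
qed

lemma norm_bound:
  assumes C: "finite \<C>" "card \<C> \<le> 12" and q: "continuous_on (\<Union>(mesh \<C> \<delta>)) q" "integral (\<Union>(mesh \<C> \<delta>)) q = 0"
    and near: "\<And>R. R \<in> \<C> \<Longrightarrow> cell_near q0 B R" and "0 \<le> B"
  shows "L2_norm_on (\<Union>(mesh \<C> \<delta>)) q \<le> 5 * B"
proof -
  define \<P> where "\<P> = mesh \<C> \<delta>"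
  note mesh = compact_mesh[OF C(1), where \<delta>=\<delta>, folded \<P>_def]
  have fin: "finite \<P>" and comp: "compact (\<Union>\<P>)" "\<And>K. K \<in> \<P> \<Longrightarrow> compact K" and card: "card \<P> \<le> 24"
    using mesh C(2) by auto
  from comp(1) have "integral (\<Union>\<P>) (\<lambda>x. (q x)\<^sup>2) \<le> integral (\<Union>\<P>) (\<lambda>x. (q x - q0)\<^sup>2)"
    using q unfolding \<P>_def[symmetric] by (intro integral_square_shift)
  also have "\<dots> \<le> (\<Sum>K\<in>\<P>. integral K (\<lambda>x. (q x - q0)\<^sup>2))"
    using fin comp q(1) unfolding \<P>_def[symmetric]
    by (intro integral_Union_le continuous_intros) auto
  also have "\<dots> \<le> (\<Sum>K\<in>\<P>. B\<^sup>2)"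
  proof (rule sum_mono)
    fix K assume "K \<in> \<P>"
    then obtain a b c d where "(a, b, c, d) \<in> \<C>" "K \<in> split_cell (\<delta> (a, b, c, d)) (a, b, c, d)"
      unfolding \<P>_def mesh_def by auto
    then show "integral K (\<lambda>x. (q x - q0)\<^sup>2) \<le> B\<^sup>2"
      using triangle_square_bound near by blast
  qed
  also have "\<dots> = card \<P> * B\<^sup>2" by simp
  also have "\<dots> \<le> 24 * B\<^sup>2" using card by (intro mult_right_mono) auto
  also have "\<dots> \<le> (5 * B)\<^sup>2" by (simp add: power_mult_distrib)
  finally show ?thesis
    unfolding L2_norm_on_def \<P>_def using \<open>0 \<le> B\<close> by (intro real_le_lsqrt) auto
qed

end

section \<open>The partitions of the edge patches\<close>

lemma non_overlapping_pair:
  assumes "a < b" "b < e" "c < d"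
  shows "non_overlapping {(a, b, c, d), (b, e, c, d)}"
  unfolding non_overlapping_def using assms by (auto simp: less_imp_le)

lemma non_overlapping_Un_below:
  assumes "non_overlapping A" "non_overlapping B"
    and "\<And>a b c d. (a, b, c, d) \<in> A \<Longrightarrow> d \<le> y" "\<And>a b c d. (a, b, c, d) \<in> B \<Longrightarrow> y \<le> c"
  shows "non_overlapping (A \<union> B)"
  unfolding non_overlapping_def
proof (intro conjI allI impI)
  fix a b c d a' b' c' d'
  assume R: "(a, b, c, d) \<in> A \<union> B"
  show "a < b" "c < d"
    using R non_overlapping_proper[OF assms(1), of a b c d] non_overlapping_proper[OF assms(2), of a b c d] by blast+
  assume R': "(a', b', c', d') \<in> A \<union> B" and ne: "(a, b, c, d) \<noteq> (a', b', c', d')"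
  consider "(a, b, c, d) \<in> A" "(a', b', c', d') \<in> A" | "(a, b, c, d) \<in> B" "(a', b', c', d') \<in> B"
    | "(a, b, c, d) \<in> A" "(a', b', c', d') \<in> B" | "(a, b, c, d) \<in> B" "(a', b', c', d') \<in> A"
    using R R' by blast
  then show "b \<le> a' \<or> b' \<le> a \<or> d \<le> c' \<or> d' \<le> c"
  proof cases
    case 1 then show ?thesis by (rule non_overlapping_disjoint[OF assms(1) _ _ ne])
  next
    case 2 then show ?thesis by (rule non_overlapping_disjoint[OF assms(2) _ _ ne])
  next
    case 3 then show ?thesis using assms(3)[of a b c d] assms(4)[of a' b' c' d'] by linarith
  next
    case 4 then show ?thesis using assms(4)[of a b c d] assms(3)[of a' b' c' d'] by linarith
  qed
qed

lemma non_overlapping_transpose_iff: "non_overlapping (transpose_cell ` \<C>) \<longleftrightarrow> non_overlapping \<C>"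
  using non_overlapping_transpose[of \<C>] non_overlapping_transpose[of "transpose_cell ` \<C>"]
  by (auto simp: image_image)

lemma non_overlapping_two_rows:
  assumes "a < b" "b < e" "c < d" "d < f"
  shows "non_overlapping ({(a, b, c, d), (b, e, c, d)} \<union> {(a, b, d, f), (b, e, d, f)})"
  by (rule non_overlapping_Un_below[where y=d]) (use assms in \<open>auto intro: non_overlapping_pair\<close>)

lemma edge_partition_finite: "edge_partition \<sigma> \<C> \<Longrightarrow> finite \<C> \<and> card \<C> \<le> 12"
proof (induction rule: edge_partition.induct)
  case (type_d h H L)
  then show ?case by (simp add: card_insert_if)
next
  case (type_e h H L)
  then show ?case by (simp add: card_insert_if)
next
  case (type_f h1 A1 h2 A2 m1 m2 T1 T2)
  define M where "M = {(h1, m1, h2, m2), (m1, A1, h2, m2), (h1, m1, m2, A2), (m1, A1, m2, A2)}"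
  have "finite T1 \<and> card T1 \<le> 4" using type_f(11) by (elim disjE; hypsubst) (simp_all add: card_insert_if)
  moreover have "finite T2 \<and> card T2 \<le> 4" using type_f(12) by (elim disjE; hypsubst) (simp_all add: card_insert_if)
  moreover have "finite M \<and> card M \<le> 4" unfolding M_def by (simp add: card_insert_if)
  moreover have "card (T1 \<union> T2 \<union> M) \<le> card T1 + card T2 + card M"
    using card_Un_le[of "T1 \<union> T2" M] card_Un_le[of T1 T2] by linarith
  ultimately show ?case unfolding M_def[symmetric] by auto
qed

lemma edge_partition_non_overlapping:
  assumes "1 \<le> \<sigma>" "edge_partition \<sigma> \<C>"
  shows "non_overlapping \<C>"
  using assms(2)
proof (induction rule: edge_partition.induct)
  case (type_d h H L)
  have "0 < H / \<sigma>" using type_d assms(1) by simp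
  then have "0 < L" using type_d by linarith
  then show ?case
    by (intro non_overlapping_Un_below[where y=h] non_overlapping_pair) (use type_d in auto)
next
  case (type_e h H L)
  have "0 < H / \<sigma>" using type_e assms(1) by simp
  then have "0 < L" using type_e by linarith
  then have "non_overlapping (({(-H, 0, -h, 0), (0, H, -h, 0)} \<union> {(-H, 0, 0, h), (0, H, 0, h)}) \<union>
       {(-H, 0, h, h + L), (0, H, h, h + L)})"
    by (intro non_overlapping_Un_below[where y=h] non_overlapping_pair non_overlapping_two_rows) (use type_e in auto)
  then show ?case by (simp add: insert_commute Un_insert_left)
next
  case (type_f h1 A1 h2 A2 m1 m2 T1 T2)
  define M where "M = {(h1, m1, h2, m2), (m1, A1, h2, m2), (h1, m1, m2, A2), (m1, A1, m2, A2)}"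
  have ord: "h1 < m1" "m1 < A1" "h2 < m2" "m2 < A2" using type_f(1-4,9,10) by auto
  have T1: "non_overlapping T1" "\<And>a b c d. (a, b, c, d) \<in> T1 \<Longrightarrow> d \<le> h2"
  proof -
    have "non_overlapping {(h1, m1, 0, h2), (m1, A1, 0, h2)}"
      by (rule non_overlapping_pair) (use ord type_f(3) in auto)
    moreover have "non_overlapping ({(h1, m1, 0, h2 / 2), (m1, A1, 0, h2 / 2)} \<union> {(h1, m1, h2 / 2, h2), (m1, A1, h2 / 2, h2)})"
      by (rule non_overlapping_two_rows) (use ord type_f(3) in auto)
    ultimately show "non_overlapping T1" using type_f(11) by (elim disjE; hypsubst) (simp_all add: insert_commute)
    show "\<And>a b c d. (a, b, c, d) \<in> T1 \<Longrightarrow> d \<le> h2" using type_f(3,11) by (elim disjE; hypsubst) auto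
  qed
  have T2: "non_overlapping T2" "\<And>a b c d. (a, b, c, d) \<in> T2 \<Longrightarrow> b \<le> h1 \<and> h2 \<le> c"
  proof -
    have "non_overlapping {(h2, m2, 0, h1), (m2, A2, 0, h1)}"
      by (rule non_overlapping_pair) (use ord type_f(1) in auto)
    moreover have "non_overlapping ({(h2, m2, 0, h1 / 2), (m2, A2, 0, h1 / 2)} \<union> {(h2, m2, h1 / 2, h1), (m2, A2, h1 / 2, h1)})"
      by (rule non_overlapping_two_rows) (use ord type_f(1) in auto)
    ultimately have "non_overlapping (transpose_cell ` T2)"
      using type_f(12) by (elim disjE; hypsubst) (simp_all add: insert_commute)
    then show "non_overlapping T2" by (simp add: non_overlapping_transpose_iff)
    show "\<And>a b c d. (a, b, c, d) \<in> T2 \<Longrightarrow> b \<le> h1 \<and> h2 \<le> c" using type_f(1,12) ord by (elim disjE; hypsubst) auto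
  qed
  have "M = {(h1, m1, h2, m2), (m1, A1, h2, m2)} \<union> {(h1, m1, m2, A2), (m1, A1, m2, A2)}"
    by (auto simp: M_def)
  then have M: "non_overlapping M" "\<And>a b c d. (a, b, c, d) \<in> M \<Longrightarrow> h1 \<le> a \<and> h2 \<le> c"
    using non_overlapping_two_rows[OF ord] ord by auto
  have "non_overlapping (transpose_cell ` T2 \<union> transpose_cell ` M)"
    by (rule non_overlapping_Un_below[where y=h1]) (use T2 M in \<open>auto simp: non_overlapping_transpose_iff transpose_cell_image\<close>)
  then have "non_overlapping (T2 \<union> M)" by (simp add: image_Un[symmetric] non_overlapping_transpose_iff)
  then have "non_overlapping (T1 \<union> (T2 \<union> M))"
    by (rule non_overlapping_Un_below[OF T1(1), where y=h2]) (use T1 T2 M in auto)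
  then show ?case by (simp add: M_def Un_assoc)
qed

section \<open>Vertex values on an edge patch\<close>

context controlled_mesh
begin

definition pair_near :: "real \<Rightarrow> real \<Rightarrow> real \<Rightarrow> real \<Rightarrow> real \<Rightarrow> real \<Rightarrow> real \<Rightarrow> bool" where
  "pair_near q0 B a b e c d \<longleftrightarrow> (\<forall>s\<in>{a, b, e}. \<forall>t\<in>{c, d}.
     \<bar>q (point s t) - q0\<bar> * sqrt ((b - a) * (d - c)) \<le> B)"

lemma pair_near_cells:
  assumes "pair_near q0 B a b e c d" "e - b = b - a" "B \<le> B'"
  shows "cell_near q0 B' (a, b, c, d)" "cell_near q0 B' (b, e, c, d)"
proof -
  have "\<bar>q (point s t) - q0\<bar> * sqrt ((b - a) * (d - c)) \<le> B'" if "s \<in> {a, b, e}" "t \<in> {c, d}" for s t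
    using assms(1,3) that unfolding pair_near_def by (meson order_trans)
  then show "cell_near q0 B' (a, b, c, d)" "cell_near q0 B' (b, e, c, d)"
    unfolding cell_near_def case_prod_conv assms(2) by blast+
qed

lemma regular_pair_near:
  assumes "(a, b, c, d) \<in> \<C>" "(b, e, c, d) \<in> \<C>" "e - b = b - a"
    and "1 \<le> \<kappa>" "d - c \<le> \<kappa> * (b - a)" "b - a \<le> \<kappa> * (d - c)"
  shows "pair_near (q (point b c)) (84 * \<kappa> * S) a b e c d"
  unfolding pair_near_def using regular_pair[OF assms] by blast

lemma pair_near_below:
  assumes "pair_near q0 B a b e y z"
    and "(a, b, x, y) \<in> \<C>" "(b, e, x, y) \<in> \<C>" "e - b = b - a"
    and "1 \<le> \<kappa>" "y - x \<le> \<kappa> * (b - a)" "0 \<le> \<rho>" "y - x \<le> \<rho>\<^sup>2 * (z - y)"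
  shows "pair_near q0 (36 * \<kappa> * S + \<rho> * B) a b e x y"
  unfolding pair_near_def
proof (intro ballI)
  fix s t assume "s \<in> {a, b, e}" "t \<in> {x, y}"
  then show "\<bar>q (point s t) - q0\<bar> * sqrt ((b - a) * (y - x)) \<le> 36 * \<kappa> * S + \<rho> * B"
    using assms(1) unfolding pair_near_def
    by (intro flat_pair[OF assms(2-6) _ assms(7,8)]) auto
qed

end

text \<open>The bound 336 \<open>\<sigma>\<close> of the regular part, passed on twice by x
\<open>\<mapsto>\<close> 72 \<open>\<sigma>\<close> + 2 \<open>\<sigma>\<close> x: a flat part
consists of at most two rows.\<close>

definition patch_constant :: "real \<Rightarrow> real" where
  "patch_constant \<sigma> = 72 * \<sigma> + 2 * \<sigma> * (72 * \<sigma> + 2 * \<sigma> * (336 * \<sigma>))"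

lemma patch_constant_chain:
  assumes "1 \<le> \<sigma>" "0 \<le> S"
  shows "336 * \<sigma> * S \<le> patch_constant \<sigma> * S" "36 * (2 * \<sigma>) * S + 2 * \<sigma> * (336 * \<sigma> * S) \<le> patch_constant \<sigma> * S"
    "36 * (2 * \<sigma>) * S + 2 * \<sigma> * (36 * (2 * \<sigma>) * S + 2 * \<sigma> * (336 * \<sigma> * S)) \<le> patch_constant \<sigma> * S"
proof -
  have step: "x \<le> 72 * \<sigma> + 2 * \<sigma> * x" if "0 \<le> x" for x
    using mult_right_mono[of 1 "2 * \<sigma>" x] assms(1) that by simp
  have 0: "0 \<le> 72 * \<sigma> + 2 * \<sigma> * (336 * \<sigma>)" using assms(1) by simp
  have 2: "72 * \<sigma> + 2 * \<sigma> * (336 * \<sigma>) \<le> patch_constant \<sigma>"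
    unfolding patch_constant_def by (rule step[OF 0])
  have 1: "336 * \<sigma> \<le> 72 * \<sigma> + 2 * \<sigma> * (336 * \<sigma>)" by (rule step) (use assms(1) in simp)
  show "336 * \<sigma> * S \<le> patch_constant \<sigma> * S"
    using 1 2 assms(2) by (intro mult_right_mono) auto
  have "(72 * \<sigma> + 2 * \<sigma> * (336 * \<sigma>)) * S \<le> patch_constant \<sigma> * S"
    using 2 assms(2) by (intro mult_right_mono) auto
  then show "36 * (2 * \<sigma>) * S + 2 * \<sigma> * (336 * \<sigma> * S) \<le> patch_constant \<sigma> * S"
    by (simp add: algebra_simps)
  show "36 * (2 * \<sigma>) * S + 2 * \<sigma> * (36 * (2 * \<sigma>) * S + 2 * \<sigma> * (336 * \<sigma> * S)) \<le> patch_constant \<sigma> * S"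
    by (simp add: patch_constant_def algebra_simps)
qed

lemma scale_facts:
  fixes x :: real
  assumes "1 \<le> \<sigma>" "0 \<le> x"
  shows "x \<le> \<sigma> * x" "4 * \<sigma> * x \<le> (2 * \<sigma>)\<^sup>2 * x" "2 * x \<le> (2 * \<sigma>)\<^sup>2 * x"
proof -
  have "\<sigma> \<le> \<sigma>\<^sup>2" "1 \<le> \<sigma>\<^sup>2"
    using assms(1) by (simp_all only: self_le_power one_le_power pos2)
  then have s: "4 * \<sigma> \<le> (2 * \<sigma>)\<^sup>2" "2 \<le> (2 * \<sigma>)\<^sup>2"
    by (simp_all add: power_mult_distrib)
  show "x \<le> \<sigma> * x" using mult_right_mono[OF assms] by simp
  show "4 * \<sigma> * x \<le> (2 * \<sigma>)\<^sup>2 * x" "2 * x \<le> (2 * \<sigma>)\<^sup>2 * x"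
    using mult_right_mono[OF s(1) assms(2)] mult_right_mono[OF s(2) assms(2)] by simp_all
qed

context controlled_mesh
begin

lemma attached_rows:
  assumes top: "pair_near q0 (336 * \<sigma> * S) a b e y z" and \<sigma>: "1 \<le> \<sigma>"
    and T: "T = {(a, b, x, y), (b, e, x, y)} \<or>
      T = {(a, b, x, m), (b, e, x, m), (a, b, m, y), (b, e, m, y)}" "T \<subseteq> \<C>"
    and m: "m = (x + y) / 2" and e: "e - b = b - a"
    and h: "x < y" "y - x \<le> 2 * \<sigma> * (b - a)" "y - x \<le> (2 * \<sigma>)\<^sup>2 * (z - y)" and R: "R \<in> T"
  shows "cell_near q0 (patch_constant \<sigma> * S) R"
  using T(1)
proof
  note c = patch_constant_chain[OF \<sigma> S_nonneg]
  assume T1: "T = {(a, b, x, y), (b, e, x, y)}"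
  have "pair_near q0 (36 * (2 * \<sigma>) * S + 2 * \<sigma> * (336 * \<sigma> * S)) a b e x y"
    by (rule pair_near_below[OF top]) (use T1 T(2) \<sigma> e h in auto)
  from pair_near_cells[OF this e c(2)] show ?thesis using R T1 by blast
next
  note c = patch_constant_chain[OF \<sigma> S_nonneg]
  assume T2: "T = {(a, b, x, m), (b, e, x, m), (a, b, m, y), (b, e, m, y)}"
  have d: "y - m = (y - x) / 2" "m - x = (y - x) / 2" using m by (simp_all add: field_simps)
  have upper: "pair_near q0 (36 * (2 * \<sigma>) * S + 2 * \<sigma> * (336 * \<sigma> * S)) a b e m y"
    by (rule pair_near_below[OF top]) (use T2 T(2) \<sigma> e h d in auto)
  have "1 * (m - x) \<le> (2 * \<sigma>)\<^sup>2 * (y - m)"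
    unfolding d using \<sigma> h(1) one_le_power[of "2 * \<sigma>" 2] by (intro mult_right_mono) auto
  then have step: "m - x \<le> (2 * \<sigma>)\<^sup>2 * (y - m)" by simp
  have lower: "pair_near q0 (36 * (2 * \<sigma>) * S + 2 * \<sigma> * (36 * (2 * \<sigma>) * S + 2 * \<sigma> * (336 * \<sigma> * S))) a b e x m"
    by (rule pair_near_below[OF upper _ _ e _ _ _ step]) (use T2 T(2) \<sigma> h(1,2) d in auto)
  from pair_near_cells[OF upper e c(2)] pair_near_cells[OF lower e c(3)] show ?thesis using R T2 by blast
qed

lemma pair_near_mono: "\<lbrakk>pair_near q0 B a b e c d; B \<le> B'\<rbrakk> \<Longrightarrow> pair_near q0 B' a b e c d"
  unfolding pair_near_def by (meson order_trans)

text \<open>Types (d) and (e): all patches made of a regular pair and a flat part below it.\<close>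

lemma flat_below_regular:
  assumes C: "T = {(- H, 0, - h, h), (0, H, - h, h)} \<or>
      T = {(- H, 0, - h, 0), (0, H, - h, 0), (- H, 0, 0, h), (0, H, 0, h)}"
      "\<C> = T \<union> {(- H, 0, h, h + L), (0, H, h, h + L)}"
    and h: "0 < h" "h \<le> H" "H / \<sigma> \<le> L" "L \<le> \<sigma> * H" and \<sigma>: "1 \<le> \<sigma>"
  shows "\<exists>q0. \<forall>R\<in>\<C>. cell_near q0 (patch_constant \<sigma> * S) R"
proof -
  note c = patch_constant_chain[OF \<sigma> S_nonneg]
  have "0 < H" using h by simp
  then have "0 < H / \<sigma>" using \<sigma> by simp
  then have "0 < L" using h by linarith
  have ratio: "H \<le> \<sigma> * L" using h(3) \<sigma> by (simp add: field_simps)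
  have \<sigma>H: "H \<le> \<sigma> * H" using scale_facts(1)[OF \<sigma>, of H] \<open>0 < H\<close> by simp
  have \<sigma>L: "4 * \<sigma> * L \<le> (2 * \<sigma>)\<^sup>2 * L" "0 \<le> \<sigma> * L" using scale_facts(2)[OF \<sigma>, of L] \<open>0 < L\<close> \<sigma> by simp_all
  define q0 where "q0 = q (point 0 h)"
  have k: "84 * (2 * \<sigma>) * S \<le> 336 * \<sigma> * S" using \<sigma> S_nonneg by simp
  have top: "pair_near q0 (336 * \<sigma> * S) (- H) 0 H h (h + L)"
    unfolding q0_def
    by (rule pair_near_mono[OF regular_pair_near k]) (use h C ratio \<sigma> \<open>0 < H\<close> \<open>0 < L\<close> in auto)
  have f: "h - - h \<le> 2 * \<sigma> * (0 - - H)" "h - - h \<le> (2 * \<sigma>)\<^sup>2 * (h + L - h)"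
  proof -
    show "h - - h \<le> 2 * \<sigma> * (0 - - H)" using h(2) \<sigma>H by simp
    have "h - - h \<le> (2 * \<sigma>)\<^sup>2 * L" using h(2) ratio \<sigma>L by linarith
    then show "h - - h \<le> (2 * \<sigma>)\<^sup>2 * (h + L - h)" by simp
  qed
  have "cell_near q0 (patch_constant \<sigma> * S) R" if "R \<in> T" for R
    by (rule attached_rows[OF top \<sigma> C(1) _ _ _ _ f that]) (use C(2) h(1) in auto)
  then show ?thesis
    using pair_near_cells[OF top _ c(1)] C(2) by (intro exI[of _ q0]) auto
qed

text \<open>In type (f) the flat part T1 lies below the lower row of M', and T2 lies below the
left column of M' after exchanging the coordinates.\<close>

lemma edge_patch_near:
  assumes "edge_partition \<sigma> \<C>" "1 \<le> \<sigma>"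
  shows "\<exists>q0. \<forall>R\<in>\<C>. cell_near q0 (patch_constant \<sigma> * S) R"
proof -
  note c = patch_constant_chain[OF assms(2) S_nonneg]
  have k: "84 * (2 * \<sigma>) * S \<le> 336 * \<sigma> * S" using assms(2) S_nonneg by simp
  show ?thesis
    using assms(1)
  proof cases
    case (type_d h H L)
    show ?thesis by (rule flat_below_regular[OF _ _ type_d(2-5) assms(2)]) (use type_d(1) in auto)
  next
    case (type_e h H L)
    show ?thesis by (rule flat_below_regular[OF _ _ type_e(2-5) assms(2)]) (use type_e(1) in auto)
  next
    case (type_f h1 A1 h2 A2 m1 m2 T1 T2)
    define w h where "w = m1 - h1" and "h = m2 - h2"
    have pos: "0 < A1" "0 < A2" "0 < h1" "0 < h2" "0 < w" "0 < h"
      and eq: "A1 - m1 = w" "m1 - h1 = w" "A2 - m2 = h" "m2 - h2 = h"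
      and size: "h1 \<le> 2 * w" "h2 \<le> 2 * h" "A1 \<le> 4 * w" "A2 \<le> 4 * h" "2 * w \<le> A1" "2 * h \<le> A2"
      using type_f(2-5,10,11) by (auto simp: w_def h_def field_simps)
    have A: "A1 \<le> \<sigma> * A2" "A2 \<le> \<sigma> * A1"
      using type_f(6,7) pos assms(2) by (simp_all add: field_simps)
    have sA: "\<sigma> * A1 \<le> \<sigma> * (4 * w)" "\<sigma> * A2 \<le> \<sigma> * (4 * h)" using size assms(2) by simp_all
    have ratio: "w \<le> 2 * \<sigma> * h" "h \<le> 2 * \<sigma> * w" "h2 \<le> 2 * \<sigma> * w" "h1 \<le> 2 * \<sigma> * h"
      using A sA size type_f(3,5) by linarith+
    have flat: "h1 \<le> (2 * \<sigma>)\<^sup>2 * w" "h2 \<le> (2 * \<sigma>)\<^sup>2 * h"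
      using size(1,2) scale_facts(3)[OF assms(2), of w] scale_facts(3)[OF assms(2), of h] pos by linarith+
    define M where "M = {(h1, m1, h2, m2), (m1, A1, h2, m2), (h1, m1, m2, A2), (m1, A1, m2, A2)}"
    have C: "\<C> = T1 \<union> T2 \<union> M" using type_f(1) by (simp add: M_def)
    define q0 where "q0 = q (point m1 m2)"
    have lower: "pair_near (q (point m1 h2)) (84 * (2 * \<sigma>) * S) h1 m1 A1 h2 m2"
      by (rule regular_pair_near) (use assms(2) C ratio eq in \<open>auto simp: M_def\<close>)
    have upper: "pair_near q0 (84 * (2 * \<sigma>) * S) h1 m1 A1 m2 A2"
      unfolding q0_def by (rule regular_pair_near) (use assms(2) C ratio eq in \<open>auto simp: M_def\<close>)
    \<comment> \<open>Both rows contain the point (m1, m2), through which the lower row is compared to q0.\<close>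
    have lower': "pair_near q0 (336 * \<sigma> * S) h1 m1 A1 h2 m2"
      unfolding pair_near_def
    proof (intro ballI)
      fix s t assume st: "s \<in> {h1, m1, A1}" "t \<in> {h2, m2}"
      define N where "N = sqrt ((m1 - h1) * (m2 - h2))"
      have "0 \<le> N" using pos eq by (simp add: N_def)
      have "\<bar>q (point s t) - q (point m1 h2)\<bar> * N \<le> 84 * (2 * \<sigma>) * S"
        "\<bar>q (point m1 m2) - q (point m1 h2)\<bar> * N \<le> 84 * (2 * \<sigma>) * S"
        using lower st unfolding pair_near_def N_def[symmetric] by blast+
      moreover have "\<bar>q (point s t) - q0\<bar> \<le> \<bar>q (point s t) - q (point m1 h2)\<bar> + \<bar>q (point m1 m2) - q (point m1 h2)\<bar>"
        unfolding q0_def by linarith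
      then have "\<bar>q (point s t) - q0\<bar> * N \<le> (\<bar>q (point s t) - q (point m1 h2)\<bar> + \<bar>q (point m1 m2) - q (point m1 h2)\<bar>) * N"
        using \<open>0 \<le> N\<close> by (rule mult_right_mono)
      ultimately show "\<bar>q (point s t) - q0\<bar> * sqrt ((m1 - h1) * (m2 - h2)) \<le> 336 * \<sigma> * S"
        unfolding N_def[symmetric] distrib_right by linarith
    qed
    have upper': "pair_near q0 (336 * \<sigma> * S) h1 m1 A1 m2 A2" by (rule pair_near_mono[OF upper k])
    interpret tr: controlled_mesh origin g2 g1 "transpose_cell ` \<C>" "\<delta> \<circ> transpose_cell" q S
      by (rule transposed_controlled)
    have left: "tr.pair_near q0 (336 * \<sigma> * S) h2 m2 A2 h1 m1"
      unfolding tr.pair_near_def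
    proof (intro ballI)
      fix s t assume "s \<in> {h2, m2, A2}" "t \<in> {h1, m1}"
      then have "\<bar>q (point t s) - q0\<bar> * sqrt (w * h) \<le> 336 * \<sigma> * S"
        using lower' upper' unfolding pair_near_def eq by blast
      then show "\<bar>q (tr.point s t) - q0\<bar> * sqrt ((m2 - h2) * (m1 - h1)) \<le> 336 * \<sigma> * S"
        by (simp add: transposed_point eq mult.commute)
    qed
    have n1: "cell_near q0 (patch_constant \<sigma> * S) R" if "R \<in> T1" for R
      by (rule attached_rows[OF lower' assms(2), of T1 0 "h2 / 2"])
        (use type_f(12) C that eq ratio flat pos in auto)
    have T2: "transpose_cell ` T2 = {(h2, m2, 0, h1), (m2, A2, 0, h1)} \<or>
      transpose_cell ` T2 = {(h2, m2, 0, h1 / 2), (m2, A2, 0, h1 / 2), (h2, m2, h1 / 2, h1), (m2, A2, h1 / 2, h1)}"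
      using type_f(13) by (elim disjE; hypsubst) (simp_all add: insert_commute)
    have n2: "cell_near q0 (patch_constant \<sigma> * S) R" if "R \<in> T2" for R
    proof -
      have "tr.cell_near q0 (patch_constant \<sigma> * S) (transpose_cell R)"
        by (rule tr.attached_rows[OF left assms(2), of "transpose_cell ` T2" 0 "h1 / 2"])
          (use T2 C that eq ratio flat pos in auto)
      moreover obtain a b c d where "R = (a, b, c, d)" by (cases R) auto
      ultimately show ?thesis
        by (simp add: tr.cell_near_def cell_near_def transposed_point mult.commute)
    qed
    have n3: "cell_near q0 (patch_constant \<sigma> * S) R" if "R \<in> M" for R
      using that pair_near_cells[OF lower' _ c(1)] pair_near_cells[OF upper' _ c(1)] eq
      unfolding M_def by auto
    show ?thesis using n1 n2 n3 unfolding C by blast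
  qed
qed

end

section \<open>The inf-sup condition\<close>

lemma triangle_square_integral:
  assumes dual: "dual_vectors c a b l m" and q: "poly_on 1 (convex hull {a, b, c}) q"
  shows "((\<lambda>x. (q x)\<^sup>2) has_integral measure lebesgue (convex hull {a, b, c}) / 12 *
    ((q a)\<^sup>2 + (q b)\<^sup>2 + (q c)\<^sup>2 + (q a + q b + q c)\<^sup>2)) (convex hull {a, b, c})"
proof (rule has_integral_eq[OF _ has_integral_eq_rhs[OF has_integral_triangle_quadratic[OF dual,
    of "(q c)\<^sup>2" "2 * q c * (q a - q c)" "2 * q c * (q b - q c)" "(q a - q c)\<^sup>2"
      "2 * (q a - q c) * (q b - q c)" "(q b - q c)\<^sup>2"]]])
qed (simp_all add: poly_on_1_triangle[OF dual q] power2_eq_square field_simps)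

lemma (in coordinate_frame) split_cell_dual_vectors:
  assumes "K \<in> split_cell \<delta> (a, b, c, d)" "a < b" "c < d"
  obtains A B C l m where "K = convex hull {A, B, C}" "dual_vectors C A B l m"
proof -
  have "a \<noteq> b" "b \<noteq> a" "c \<noteq> d" using assms(2,3) by auto
  note p = diagonal_pair[OF this(1,3)] diagonal_pair[OF this(2,3)]
  note d = triangle_pair.dual1[OF p(1)] triangle_pair.dual2[OF p(1)] triangle_pair.dual1[OF p(2)] triangle_pair.dual2[OF p(2)]
  show ?thesis
    using split_cell_cases[OF assms(1)] by (elim disjE) (rule that, assumption, rule d)+
qed

text \<open>A pressure that vanishes at the vertices of a triangle vanishes on the triangle.\<close>

lemma (in coordinate_frame) L2_norm_pos:
  fixes \<delta> :: "rectangle \<Rightarrow> bool"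
  assumes "non_overlapping \<C>" "finite \<C>"
  defines "\<P> \<equiv> mesh \<C> \<delta>"
  assumes q: "q \<in> pressure_space \<P> (\<Union>\<P>)" "nonzero_on (\<Union>\<P>) q"
  shows "0 < L2_norm_on (\<Union>\<P>) q"
proof -
  obtain x K where x: "q x \<noteq> 0" "x \<in> K" "K \<in> \<P>" using q(2) unfolding nonzero_on_def by blast
  obtain R where R: "R \<in> \<C>" "K \<in> split_cell (\<delta> R) R" using x(3) unfolding \<P>_def mesh_def by blast
  obtain a b c d where abcd: "R = (a, b, c, d)" by (cases R) auto
  have pos: "a < b" "c < d" using non_overlapping_proper[OF assms(1)] R(1) abcd by blast+
  obtain A B C l m where K: "K = convex hull {A, B, C}" and dual: "dual_vectors C A B l m"
    using split_cell_dual_vectors[OF R(2)[unfolded abcd] pos] by blast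
  have qK: "poly_on 1 K q" using q(1) x(3) unfolding pressure_space_def by blast
  have "q A \<noteq> 0 \<or> q B \<noteq> 0 \<or> q C \<noteq> 0"
    using hull3_abs_le[OF qK[unfolded K] x(2)[unfolded K], of 0 0] x(1) by auto
  then have "0 < (q A)\<^sup>2 + (q B)\<^sup>2 + (q C)\<^sup>2"
    by (metis add_nonneg_eq_0_iff add_nonneg_nonneg less_eq_real_def zero_eq_power2 zero_le_power2)
  then have p: "0 < (q A)\<^sup>2 + (q B)\<^sup>2 + (q C)\<^sup>2 + (q A + q B + q C)\<^sup>2"
    by (rule add_pos_nonneg) simp
  note i = triangle_square_integral[OF dual qK[unfolded K], folded K]
  have "0 < integral K (\<lambda>x. (q x)\<^sup>2)"
    unfolding integral_unique[OF i] using p measure_triangle_pos[OF dual, folded K] by simp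
  also have "integral K (\<lambda>x. (q x)\<^sup>2) \<le> integral (\<Union>\<P>) (\<lambda>x. (q x)\<^sup>2)"
  proof (rule integral_subset_le)
    have "compact (\<Union>\<P>)" unfolding \<P>_def by (rule compact_mesh(1)[OF assms(2)])
    then show "(\<lambda>x. (q x)\<^sup>2) integrable_on \<Union>\<P>"
      using q(1) unfolding pressure_space_def
      by (intro continuous_on_compact_integrable continuous_intros) auto
    show "(\<lambda>x. (q x)\<^sup>2) integrable_on K" using i by blast
  qed (use x(3) in auto)
  finally show ?thesis by (simp add: L2_norm_on_def)
qed

lemma rigid_motion_frame:
  fixes f :: "real^2 \<Rightarrow> real^2"
  assumes "orthogonal_transformation f"
  shows "coordinate_frame (f (axis 1 1)) (f (axis 2 1))"
proof -
  have "f x \<bullet> f y = x \<bullet> y" for x y using assms by (simp add: orthogonal_transformation_def)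
  then show ?thesis by unfold_locales (simp_all add: inner_axis_axis inner_real_def)
qed

lemma rigid_motion_mesh:
  assumes f: "orthogonal_transformation f"
  shows "(\<lambda>K. (\<lambda>x. a + f x) ` K) ` (\<Union>R\<in>\<C>. diagonal_split (\<delta> R) R) =
    coordinate_frame.mesh a (f (axis 1 1)) (f (axis 2 1)) \<C> \<delta>"
proof -
  interpret coordinate_frame a "f (axis 1 1)" "f (axis 2 1)" by (rule rigid_motion_frame[OF f])
  have lin: "linear f" using f by (simp add: orthogonal_transformation_def)
  have pt: "a + f (pt s t) = point s t" for s t
  proof -
    have "pt s t = s *\<^sub>R axis 1 1 + t *\<^sub>R axis 2 1"
      by (simp add: pt_def vec_eq_iff forall_2 axis_def)
    then show ?thesis
      by (simp add: point_def linear_add[OF lin] linear_scale[OF lin] add.assoc)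
  qed
  have hull: "(\<lambda>x. a + f x) ` (convex hull V) = convex hull ((\<lambda>x. a + f x) ` V)" for V
  proof -
    have "(\<lambda>x. a + f x) ` W = (+) a ` f ` W" for W by (simp add: image_image)
    then show ?thesis
      by (simp add: convex_hull_translation convex_hull_linear_image[OF lin])
  qed
  have "(\<lambda>K. (\<lambda>x. a + f x) ` K) ` diagonal_split b R = split_cell b R" for b R
  proof -
    obtain r s t u where "R = (r, s, t, u)" by (cases R) auto
    then show ?thesis by (cases b) (simp_all add: hull pt)
  qed
  then show ?thesis unfolding mesh_def image_UN by simp
qed

theorem mainTheorem3:
  fixes \<sigma> :: real
  assumes "\<sigma> \<ge> 1"
  shows "\<exists>\<beta>::real. \<beta> > 0 \<and>
    (\<forall>\<P> \<omega>. triangulated_edge_patch \<sigma> \<P> \<and> \<omega> = \<Union>\<P> \<longrightarrow>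
      (INF q\<in>{q \<in> pressure_space \<P> \<omega>. nonzero_on \<omega> q}.
        SUP v\<in>{v \<in> velocity_space \<P> \<omega>. nonzero_on \<omega> v}.
          ereal (integral \<omega> (\<lambda>x. q x * divergence v x) /
                 (H1_seminorm_on \<omega> v * L2_norm_on \<omega> q))) \<ge> ereal \<beta>)"
proof -
  define \<Gamma> where "\<Gamma> = patch_constant \<sigma>"
  have \<Gamma>: "0 < \<Gamma>" using assms by (simp add: \<Gamma>_def patch_constant_def add_pos_pos)
  have test: "\<exists>v\<in>{v \<in> velocity_space \<P> (\<Union>\<P>). nonzero_on (\<Union>\<P>) v}.
      1 / (10 * \<Gamma>) \<le> integral (\<Union>\<P>) (\<lambda>x. q x * divergence v x) / (H1_seminorm_on (\<Union>\<P>) v * L2_norm_on (\<Union>\<P>) q)"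
    if patch: "triangulated_edge_patch \<sigma> \<P>" and q: "q \<in> pressure_space \<P> (\<Union>\<P>)" "nonzero_on (\<Union>\<P>) q" for \<P> q
  proof -
    obtain \<C> \<delta> \<phi> where C: "edge_partition \<sigma> \<C>" and \<phi>: "coordinate_rigid_motion \<phi>"
      and P: "\<P> = (\<lambda>K. \<phi> ` K) ` (\<Union>R\<in>\<C>. diagonal_split (\<delta> R) R)"
      using patch unfolding triangulated_edge_patch_def by blast
    obtain a f where f: "orthogonal_transformation f" "\<phi> = (\<lambda>x. a + f x)"
      using \<phi> unfolding coordinate_rigid_motion_def by blast
    interpret fr: coordinate_frame a "f (axis 1 1)" "f (axis 2 1)" by (rule rigid_motion_frame[OF f(1)])
    have P: "\<P> = fr.mesh \<C> \<delta>" unfolding P f(2) by (rule rigid_motion_mesh[OF f(1)])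
    note cells = edge_partition_non_overlapping[OF assms C] and fin = edge_partition_finite[OF C]
    define n where "n = L2_norm_on (\<Union>\<P>) q"
    have n: "0 < n"
      unfolding n_def P by (rule fr.L2_norm_pos[OF cells]) (use fin q P in auto)
    \<comment> \<open>Half of the S for which the norm bound n \<le> 5 * (\<Gamma> * S) would be an equality.\<close>
    define S where "S = n / (10 * \<Gamma>)"
    have S: "0 \<le> S" using n \<Gamma> by (simp add: S_def)
    have "\<not> pressure_controlled \<P> q S"
    proof
      assume ctrl: "pressure_controlled \<P> q S"
      interpret controlled_mesh a "f (axis 1 1)" "f (axis 2 1)" \<C> \<delta> q S
        by unfold_locales (use cells S ctrl q in \<open>auto simp: P pressure_space_def simp del: One_nat_def\<close>)
      obtain q0 where "\<forall>R\<in>\<C>. cell_near q0 (\<Gamma> * S) R"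
        using edge_patch_near[OF C assms] unfolding \<Gamma>_def by blast
      then have "n \<le> 5 * (\<Gamma> * S)"
        unfolding n_def P using fin q \<Gamma> S
        by (intro norm_bound) (auto simp: P pressure_space_def)
      then show False using n \<Gamma> by (simp add: S_def)
    qed
    then obtain v where v: "v \<in> velocity_space \<P> (\<Union>\<P>)" "nonzero_on (\<Union>\<P>) v" "0 < H1_seminorm_on (\<Union>\<P>) v"
      "S * H1_seminorm_on (\<Union>\<P>) v < integral (\<Union>\<P>) (\<lambda>x. q x * divergence v x)"
      unfolding pressure_controlled_def by (auto simp: not_le)
    have "1 / (10 * \<Gamma>) = S * H1_seminorm_on (\<Union>\<P>) v / (H1_seminorm_on (\<Union>\<P>) v * n)"
      using v(3) n by (simp add: S_def)
    also have "\<dots> \<le> integral (\<Union>\<P>) (\<lambda>x. q x * divergence v x) / (H1_seminorm_on (\<Union>\<P>) v * n)"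
      using v(3,4) n by (intro divide_right_mono) auto
    finally show ?thesis using v(1,2) unfolding n_def by blast
  qed
  show ?thesis
  proof (intro exI[of _ "1 / (10 * \<Gamma>)"] conjI allI impI)
    show "0 < 1 / (10 * \<Gamma>)" using \<Gamma> by simp
    fix \<P> \<omega>
    assume P: "triangulated_edge_patch \<sigma> \<P> \<and> \<omega> = \<Union>\<P>"
    show "ereal (1 / (10 * \<Gamma>)) \<le> (INF q\<in>{q \<in> pressure_space \<P> \<omega>. nonzero_on \<omega> q}.
        SUP v\<in>{v \<in> velocity_space \<P> \<omega>. nonzero_on \<omega> v}.
          ereal (integral \<omega> (\<lambda>x. q x * divergence v x) /
                 (H1_seminorm_on \<omega> v * L2_norm_on \<omega> q)))"
    proof (rule INF_greatest)
      fix q assume "q \<in> {q \<in> pressure_space \<P> \<omega>. nonzero_on \<omega> q}"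
      then obtain v where "v \<in> {v \<in> velocity_space \<P> \<omega>. nonzero_on \<omega> v}"
        "1 / (10 * \<Gamma>) \<le> integral \<omega> (\<lambda>x. q x * divergence v x) / (H1_seminorm_on \<omega> v * L2_norm_on \<omega> q)"
        using test[of \<P> q] P by blast
      then show "ereal (1 / (10 * \<Gamma>)) \<le> (SUP v\<in>{v \<in> velocity_space \<P> \<omega>. nonzero_on \<omega> v}.
          ereal (integral \<omega> (\<lambda>x. q x * divergence v x) / (H1_seminorm_on \<omega> v * L2_norm_on \<omega> q)))"
        by (intro SUP_upper2) auto
    qed
  qed
qed

end
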